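(* Let $n\in\mathbb{N}$, $m\in\mathbb{Z}_+$, let $\vec{p}_m:=(p_1,\ldots,p_m)\in(1,\infty)^m$ (no exponent vector is given if $m=0$) and let $q\in(1,\infty)$. Then there exists a positive constant $C$, depending on $q$ but independent of $f$, such that, for every $f\in L^1_{\rm loc}(\mathbb{R}^n\times\mathbb{R}^m)$, $$\int_{\mathbb{R}^n}\left[T_{L^{\vec{p}_m}(\mathbb{R}^m)}(f^* )(s)\right]^q\,ds\le C\int_{\mathbb{R}^n}\left[T_{L^{\vec{p}_m}(\mathbb{R}^m)}(f)(s)\right]^q\,ds .$$
   Context: $\mathbb{N}=\{1,2,\ldots\}$, $\mathbb{Z}_+=\{0\}\cup\mathbb{N}$. For $f\in L^1_{\rm loc}(\mathbb{R}^n\times\mathbb{R}^m)$, $s\in\mathbb{R}^n$ and $t\in\mathbb{R}^m$, the partial centered Hardy--Littlewood maximal function (in the first variable) is $$f^*(s,t):=\sup_{r\in(0,\infty)}\frac1{|B(s,r)|}\int_{B(s,r)}|f(y,t)|\,dy,\qquad B(s,r):=\{z\in\mathbb{R}^n:\ |z-s|<r\},$$ where $|B(s,r)|$ is the Lebesgue measure of the Euclidean ball. If $m=0$, then $f\in L^1_{\rm loc}(\mathbb{R}^n)$, the variable $t$ is absent, and $f^*$ is the usual centered Hardy--Littlewood maximal function. For a measurable function $g$ on $\mathbb{R}^n\times\mathbb{R}^m$ and $s\in\mathbb{R}^n$: if $m\in\mathbb{N}$, $$T_{L^{\vec{p}_m}(\mathbb{R}^m)}(g)(s):=\left\{\int_{\mathbb{R}}\cdots\left[\int_{\mathbb{R}}|g(s,t_1,\ldots,t_m)|^{p_1}\,dt_1\right]^{p_2/p_1}\cdots\,dt_m\right\}^{1/p_m},$$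 and, if $m=0$, $T_{L^{\vec{p}_0}(\mathbb{R}^0)}(g)(s):=|g(s)|$. The constant $C$ may depend on the fixed quantities $n$, $m$, $\vec p_m$ and $q$. Both sides of the inequality take values in $[0,\infty]$. *)

theory Defs
  imports "HOL-Analysis.Analysis"
begin

text \<open>A point of \<open>\<real>\<^sup>m\<close> is a function \<open>t :: nat \<Rightarrow> real\<close> with coordinates
  \<open>t 1, \<dots>, t m\<close> that is \<^const>\<open>undefined\<close> outside \<open>{1..m}\<close>, so that \<open>m\<close> can be any natural
  number. For \<open>m = 0\<close> there is exactly one such point and its measure is \<open>1\<close>: a function
  on \<open>\<real>\<^sup>n \<times> \<real>\<^sup>0\<close> is a function on \<open>\<real>\<^sup>n\<close>. The completion makes measurability and
  integrability on \<open>\<real>\<^sup>n \<times> \<real>\<^sup>m\<close> those of Lebesgue.\<close>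

definition lebesgue_prod :: "nat \<Rightarrow> ((real ^ 'n) \<times> (nat \<Rightarrow> real)) measure" where
  "lebesgue_prod m = completion (lborel \<Otimes>\<^sub>M (\<Pi>\<^sub>M i\<in>{1..m}. lborel))"

text \<open>Compactness refers to the product topology on \<open>nat \<Rightarrow> real\<close>, which induces the
  Euclidean topology on the copy of \<open>\<real>\<^sup>m\<close> above.\<close>

definition locally_integrable :: "nat \<Rightarrow> ((real ^ 'n) \<times> (nat \<Rightarrow> real) \<Rightarrow> complex) \<Rightarrow> bool" where
  "locally_integrable m f \<longleftrightarrow>
     f \<in> borel_measurable (lebesgue_prod m) \<and>
     (\<forall>K. compact K \<and> K \<subseteq> space (lebesgue_prod m) \<longrightarrow> set_integrable (lebesgue_prod m) K f)"

text \<open>Only used with exponents \<open>a > 0\<close>, for which \<open>\<infinity>\<^sup>a = \<infinity>\<close> and \<open>0\<^sup>a = 0\<close>.\<close>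

definition ennreal_powr :: "ennreal \<Rightarrow> real \<Rightarrow> ennreal"  (infixr \<open>epowr\<close> 80) where
  "x epowr a = (if x = \<infinity> then \<infinity> else ennreal (enn2real x powr a))"

text \<open>\<open>f\<^sup>*\<close>. For a Lebesgue measurable \<open>f\<close> the section \<open>f(\<cdot>, t)\<close> is measurable for almost
  every \<open>t\<close> only; the values at the remaining \<open>t\<close>, where the nonnegative integral is a
  lower integral, affect none of the integrals below.\<close>

definition partial_maximal ::
  "((real ^ 'n) \<times> (nat \<Rightarrow> real) \<Rightarrow> complex) \<Rightarrow> (real ^ 'n) \<times> (nat \<Rightarrow> real) \<Rightarrow> ennreal" where
  "partial_maximal f = (\<lambda>(s, t). SUP r\<in>{0<..}.
     (\<integral>\<^sup>+ y\<in>ball s r. ennreal (norm (f (y, t))) \<partial>lebesgue) / emeasure lebesgue (ball s r))"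

text \<open>\<open>iterated_integral p k h t\<close> is
  \<open>\<integral> [ \<cdots> [ \<integral> h(t\<^sub>1, t\<^sub>2, \<dots>)\<^bsup>p\<^sub>1\<^esup> dt\<^sub>1 ]\<^bsup>p\<^sub>2/p\<^sub>1\<^esup> \<cdots> ]\<^bsup>p\<^sub>k/p\<^sub>k\<^sub>-\<^sub>1\<^esup> dt\<^sub>k\<close>: the coordinates \<open>1, \<dots>, k\<close> are
  integrated out, those beyond \<open>k\<close> are taken from \<open>t\<close>.\<close>

fun iterated_integral ::
  "(nat \<Rightarrow> real) \<Rightarrow> nat \<Rightarrow> ((nat \<Rightarrow> real) \<Rightarrow> ennreal) \<Rightarrow> (nat \<Rightarrow> real) \<Rightarrow> ennreal" where
  "iterated_integral p 0 h t = h t"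
| "iterated_integral p (Suc 0) h t = (\<integral>\<^sup>+ u. h (t(1 := u)) epowr p 1 \<partial>lebesgue)"
| "iterated_integral p (Suc (Suc k)) h t =
     (\<integral>\<^sup>+ u. iterated_integral p (Suc k) h (t(Suc (Suc k) := u))
         epowr (p (Suc (Suc k)) / p (Suc k)) \<partial>lebesgue)"

text \<open>The argument \<open>g\<close> stands for the absolute value of the function in question, so that
  the definition covers both \<open>\<bar>f\<bar>\<close> and the \<open>[0, \<infinity>]\<close>-valued \<open>f\<^sup>*\<close>.\<close>

definition mixed_norm ::
  "(nat \<Rightarrow> real) \<Rightarrow> nat \<Rightarrow> ((real ^ 'n) \<times> (nat \<Rightarrow> real) \<Rightarrow> ennreal) \<Rightarrow> real ^ 'n \<Rightarrow> ennreal" where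
  "mixed_norm p m g s =
     (if m = 0 then g (s, \<lambda>_. undefined)
      else iterated_integral p m (\<lambda>t. g (s, t)) (\<lambda>_. undefined) epowr (1 / p m))"

end

theory Submission
  imports Defs
begin

text \<open>
The maximal operator acts in the variable \<open>s\<close>, which is the outermost one of the mixed norm, while
the maximal inequality in \<open>L\<^sup>p(\<real>\<^sup>n)\<close> can be integrated over \<open>t\<^sub>1\<close> only if its exponent is \<open>p\<^sub>1\<close>, and
then over \<open>t\<^sub>2\<close> only if its exponent has meanwhile become \<open>p\<^sub>2\<close>. Weighted inequalities provide this
change of exponent. By Rubio de Francia's extrapolation theorem, if
\<open>\<integral> F\<^sup>p w \<le> K \<integral> H\<^sup>p w\<close> holds for one exponent \<open>p\<close> and all Muckenhoupt weights \<open>w\<close> of class \<open>A\<^sub>p\<close>, then it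
holds for every exponent \<open>q\<close> between \<open>1\<close> and \<open>\<infinity>\<close> and all weights of class \<open>A\<^sub>q\<close>, with a
constant that depends only on that of the weight (\<open>extrapolation\<close>). So one starts with Muckenhoupt's theorem, integrates over \<open>t\<^sub>1\<close>
with exponent \<open>p\<^sub>1\<close>, extrapolates from \<open>p\<^sub>1\<close> to \<open>p\<^sub>2\<close>, integrates over \<open>t\<^sub>2\<close>, and so on
(\<open>mixed_norm_extrapolation\<close>). In the end one extrapolates from \<open>p\<^sub>m\<close> to \<open>q\<close> and takes the weight \<open>1\<close>.

Balls are replaced by cubes. Each of the \<open>2\<^sup>n\<close> shifted triadic grids is a laminar family, and every
ball lies in a cube of comparable size from one of them (\<open>ball_average_le_mx\<close>). Within a laminar family
a covering lemma holds with constant \<open>1\<close> for every measure (\<open>laminar_covering\<close>). It yields Doob's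
inequality with a constant that depends only on the exponent (\<open>maximal_fn_strong_type\<close>), and Lerner's
argument applies it to two weighted measures in order to prove Muckenhoupt's theorem
(\<open>muckenhoupt_laminar\<close>). Moreover, the maximal function over the countably many cubes is jointly
measurable in \<open>s\<close> and \<open>t\<close>.

Weights appear as \<open>w1 w2\<^bsup>1-p\<^esup>\<close> with two weights of class \<open>A\<^sub>1\<close>, each of which is a function \<open>u\<close> with
\<open>M u \<le> c u\<close>. The algorithm of Rubio de Francia majorizes a given function by such a \<open>u\<close> of comparable
norm (\<open>rubio_de_francia\<close>), and extrapolation combines two of these majorants into a weight.

All functions take values in \<open>[0, \<infinity>]\<close>, and the estimates are phrased so as to hold there without
finiteness assumptions as far as possible. The given function is Lebesgue measurable and is replaced
by a Borel function that agrees with it almost everywhere.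
\<close>

section \<open>Real powers of extended nonnegative numbers\<close>

lemma epowr_ennreal: "0 \<le> r \<Longrightarrow> ennreal r epowr a = ennreal (r powr a)"
  by (simp add: ennreal_powr_def)

lemma epowr_top [simp]: "top epowr a = top"
  by (simp add: ennreal_powr_def)

lemma epowr_0 [simp]: "0 epowr a = 0"
  by (simp add: ennreal_powr_def)

lemma epowr_1 [simp]: "x epowr 1 = x"
  by (cases x) (simp_all add: ennreal_powr_def)

lemma epowr_mono: "0 \<le> a \<Longrightarrow> x \<le> y \<Longrightarrow> x epowr a \<le> y epowr a"
  by (cases x; cases y) (auto simp: epowr_ennreal top_unique intro!: ennreal_leI powr_mono2)

lemma epowr_epowr [simp]: "(x epowr a) epowr b = x epowr (a * b)"
  by (cases x) (simp_all add: epowr_ennreal powr_powr)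

lemma epowr_mult: "0 < a \<Longrightarrow> (x * y) epowr a = x epowr a * y epowr a"
proof (cases x; cases y)
  assume a: "0 < a"
  show "(x * y) epowr a = x epowr a * y epowr a" if "x = top" "y = top"
    using that by simp
  show "(x * y) epowr a = x epowr a * y epowr a" if "x = top" "0 \<le> r" "y = ennreal r" for r
    using that a by (cases "r = 0") (auto simp: epowr_ennreal ennreal_top_mult)
  show "(x * y) epowr a = x epowr a * y epowr a" if "0 \<le> r" "x = ennreal r" "y = top" for r
    using that a by (cases "r = 0") (auto simp: epowr_ennreal ennreal_mult_top)
  show "(x * y) epowr a = x epowr a * y epowr a"
    if "0 \<le> r" "x = ennreal r" "0 \<le> s" "y = ennreal s" for r s
    using that by (simp add: epowr_ennreal powr_mult flip: ennreal_mult)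
qed

lemma epowr_add: "x epowr (a + b) = x epowr a * x epowr b"
  by (cases x) (simp_all add: epowr_ennreal powr_add flip: ennreal_mult)

text \<open>Power functions are order isomorphisms of \<open>[0, \<infinity>]\<close>. In this form the fact reduces a bound on a
power of a supremum to a bound on the power of each of its members.\<close>

lemma epowr_le_iff:
  assumes "0 < a"
  shows "x epowr a \<le> y \<longleftrightarrow> x \<le> y epowr (1 / a)"
  using epowr_mono[of a x "y epowr (1 / a)"] epowr_mono[of "1 / a" "x epowr a" y] assms by auto

lemma epowr_eq_0_iff [simp]: "x epowr a = 0 \<longleftrightarrow> x = 0"
  by (cases x) (auto simp: epowr_ennreal)

lemma epowr_eq_top_iff [simp]: "x epowr a = top \<longleftrightarrow> x = top"
  by (cases x) (auto simp: epowr_ennreal)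

lemma measurable_epowr [measurable (raw)]:
  assumes [measurable]: "f \<in> borel_measurable M"
  shows "(\<lambda>x. f x epowr a) \<in> borel_measurable M"
  unfolding ennreal_powr_def by measurable

text \<open>Since the level set is cut out by a strict inequality, the formula holds at \<open>x = \<infinity>\<close> as well.
The maximal inequalities below can therefore be integrated over all levels before anything is
known to be finite.\<close>

lemma epowr_layer_cake:
  assumes a: "0 < a"
  shows "x epowr a = (\<integral>\<^sup>+ l. indicator {l. 0 < l \<and> ennreal l < x} l * ennreal (a * l powr (a - 1)) \<partial>lborel)"
    (is "_ = ?I")
proof -
  have *: "ennreal (r powr a) = (\<integral>\<^sup>+ l. ennreal (a * l powr (a - 1)) * indicator {0..r} l \<partial>lborel)"
    if r: "0 \<le> r" for r
  proof -
    have "((\<lambda>l. a * l powr (a - 1)) has_integral a * (r powr (a - 1 + 1) / (a - 1 + 1))) {0..r}"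
      using a r by (intro has_integral_mult_right has_integral_powr_from_0) auto
    then show ?thesis
      using nn_integral_has_integral_lebesgue'[of "{0..r}" "\<lambda>l. a * l powr (a - 1)"] a by simp
  qed
  show ?thesis
  proof (cases x)
    case (real r)
    have "?I = (\<integral>\<^sup>+ l. ennreal (a * l powr (a - 1)) * indicator {0..r} l \<partial>lborel)"
      using AE_lborel_singleton[of 0] AE_lborel_singleton[of r]
      by (intro nn_integral_cong_AE) (auto simp: real ennreal_less_iff split: split_indicator)
    then show ?thesis
      using * real by (simp add: epowr_ennreal)
  next
    case top
    have "ennreal (real n) \<le> ?I" for n
    proof -
      have "ennreal (real n) = ennreal ((real n powr (1 / a)) powr a)"
        using a by (simp add: powr_powr)
      also have "\<dots> \<le> ?I"
        unfolding *[OF powr_ge_zero]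
        using AE_lborel_singleton[of 0]
        by (intro nn_integral_mono_AE) (auto simp: top split: split_indicator)
      finally show ?thesis .
    qed
    then have "?I = top"
      by (metis ennreal_Ex_less_of_nat ennreal_of_nat_eq_real_of_nat not_le top.not_eq_extremum)
    then show ?thesis
      by (simp add: top)
  qed
qed

lemma divide_ennreal_eq_mult: "0 < b \<Longrightarrow> a / ennreal b = a * ennreal (1 / b)"
  by (simp add: divide_ennreal_def inverse_ennreal inverse_eq_divide)

section \<open>Maximal functions over laminar families\<close>

text \<open>The nesting property of dyadic cubes.\<close>

definition laminar :: "'a set set \<Rightarrow> bool" where
  "laminar D \<longleftrightarrow> (\<forall>P\<in>D. \<forall>Q\<in>D. P \<inter> Q = {} \<or> P \<subseteq> Q \<or> Q \<subseteq> P)"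

text \<open>A point that lies in no member of \<open>D\<close> gets the value \<open>0\<close>.\<close>

definition maximal_fn :: "'a measure \<Rightarrow> 'a set set \<Rightarrow> ('a \<Rightarrow> ennreal) \<Rightarrow> 'a \<Rightarrow> ennreal" where
  "maximal_fn M D g x = (SUP Q\<in>D. indicator Q x * ((\<integral>\<^sup>+ y\<in>Q. g y \<partial>M) / emeasure M Q))"

lemma average_le_maximal_fn:
  "Q \<in> D \<Longrightarrow> x \<in> Q \<Longrightarrow> (\<integral>\<^sup>+ y\<in>Q. g y \<partial>M) / emeasure M Q \<le> maximal_fn M D g x"
  unfolding maximal_fn_def by (rule SUP_upper2[of Q]) auto

lemma maximal_fn_leI:
  "(\<And>Q. Q \<in> D \<Longrightarrow> x \<in> Q \<Longrightarrow> (\<integral>\<^sup>+ y\<in>Q. g y \<partial>M) / emeasure M Q \<le> b) \<Longrightarrow> maximal_fn M D g x \<le> b"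
  unfolding maximal_fn_def by (rule SUP_least) (auto split: split_indicator)

lemma measurable_maximal_fn:
  assumes "countable D" "D \<subseteq> sets M"
  shows "maximal_fn M D g \<in> borel_measurable M"
  unfolding maximal_fn_def[abs_def]
  using assms by (intro borel_measurable_SUP borel_measurable_times_ennreal) auto

lemma maximal_fn_Union:
  "maximal_fn M (\<Union>i\<in>I. D i) g x = (SUP i\<in>I. maximal_fn M (D i) g x)"
  unfolding maximal_fn_def by (rule SUP_UNION)

lemma laminar_subset: "laminar D \<Longrightarrow> E \<subseteq> D \<Longrightarrow> laminar E"
  unfolding laminar_def by blast

text \<open>The maximal members of a finite laminar family are pairwise disjoint and cover its union, so
their measures add up without any loss. The covering constant is thus \<open>1\<close> for every measure, and
this is why the maximal inequality below is uniform over all weighted measures.\<close>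

lemma laminar_finite_covering:
  assumes "finite D" "laminar D" and sets: "D \<subseteq> sets M" and [measurable]: "h \<in> borel_measurable M"
    and le: "\<And>Q. Q \<in> D \<Longrightarrow> c * emeasure M Q \<le> (\<integral>\<^sup>+ x\<in>Q. h x \<partial>M)"
  shows "c * emeasure M (\<Union>D) \<le> (\<integral>\<^sup>+ x. h x \<partial>M)"
proof -
  define X where "X = {P \<in> D. \<forall>Q\<in>D. P \<subseteq> Q \<longrightarrow> P = Q}"
  have X: "X \<subseteq> D" "finite X"
    using \<open>finite D\<close> by (auto simp: X_def)
  have disj: "P = Q" if "P \<in> X" "Q \<in> X" "x \<in> P" "x \<in> Q" for P Q x
  proof -
    have "P \<inter> Q \<noteq> {}" "P \<in> D" "Q \<in> D"
      using that X by auto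
    then have "P \<subseteq> Q \<or> Q \<subseteq> P"
      using \<open>laminar D\<close> unfolding laminar_def by meson
    then show ?thesis
      using that by (auto simp: X_def)
  qed
  have "\<Union>D = (\<Union>Q\<in>X. Q)"
  proof (intro antisym subsetI)
    fix x assume "x \<in> \<Union>D"
    then obtain Q where "Q \<in> D" "x \<in> Q" by auto
    moreover from this obtain P where "P \<in> D" "Q \<subseteq> P" "\<forall>R\<in>D. P \<subseteq> R \<longrightarrow> P = R"
      using finite_has_maximal2[OF \<open>finite D\<close>, of Q] by auto
    ultimately show "x \<in> (\<Union>Q\<in>X. Q)"
      unfolding X_def by blast
  qed (use X in auto)
  then have "c * emeasure M (\<Union>D) \<le> c * (\<Sum>Q\<in>X. emeasure M Q)"
    using X sets emeasure_subadditive_finite[of X "\<lambda>Q. Q" M] by (intro mult_left_mono) auto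
  also have "\<dots> \<le> (\<Sum>Q\<in>X. \<integral>\<^sup>+ x\<in>Q. h x \<partial>M)"
    using X le by (auto simp: sum_distrib_left intro!: sum_mono)
  also have "\<dots> = (\<integral>\<^sup>+ x. (\<Sum>Q\<in>X. h x * indicator Q x) \<partial>M)"
    using X sets by (intro nn_integral_sum[symmetric] borel_measurable_times_ennreal) auto
  also have "\<dots> \<le> (\<integral>\<^sup>+ x. h x \<partial>M)"
  proof (rule nn_integral_mono)
    fix x
    have "(\<Sum>Q\<in>X. indicator Q x :: ennreal) \<le> 1"
    proof (cases "\<exists>P\<in>X. x \<in> P")
      case True
      then obtain P where P: "P \<in> X" "x \<in> P" by auto
      then have "(\<Sum>Q\<in>X. indicator Q x :: ennreal) = (\<Sum>Q\<in>{P}. indicator Q x)"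
        using disj X by (intro sum.mono_neutral_right) (auto simp: indicator_def)
      also have "\<dots> \<le> 1" by (simp split: split_indicator)
      finally show ?thesis .
    next
      case False
      then show ?thesis by (simp add: indicator_def sum.neutral)
    qed
    then show "(\<Sum>Q\<in>X. h x * indicator Q x) \<le> h x"
      using mult_left_mono[of "\<Sum>Q\<in>X. indicator Q x :: ennreal" 1 "h x"]
      by (simp add: sum_distrib_left)
  qed
  finally show ?thesis .
qed

text \<open>The constant in the finite case does not depend on the family, so one can exhaust \<open>D\<close> by finite
subfamilies.\<close>

lemma laminar_covering:
  assumes "countable D" "laminar D" and sets: "D \<subseteq> sets M" and [measurable]: "h \<in> borel_measurable M"
    and le: "\<And>Q. Q \<in> D \<Longrightarrow> c * emeasure M Q \<le> (\<integral>\<^sup>+ x\<in>Q. h x \<partial>M)"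
  shows "c * emeasure M (\<Union>D) \<le> (\<integral>\<^sup>+ x. h x \<partial>M)"
proof (cases "D = {}")
  case False
  define A where "A n = from_nat_into D ` {..n}" for n
  have A: "finite (A n)" "A n \<subseteq> D" for n
    using from_nat_into[OF False] by (auto simp: A_def)
  have "\<Union>D = (\<Union>n. \<Union>(A n))"
  proof (intro antisym subsetI)
    fix x assume "x \<in> \<Union>D"
    then obtain Q where "Q \<in> D" "x \<in> Q" by auto
    moreover obtain n where "from_nat_into D n = Q"
      using from_nat_into_surj[OF \<open>countable D\<close> \<open>Q \<in> D\<close>] by auto
    ultimately show "x \<in> (\<Union>n. \<Union>(A n))"
      by (auto simp: A_def)
  next
    fix x assume "x \<in> (\<Union>n. \<Union>(A n))"
    then show "x \<in> \<Union>D"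
      using A(2) by (metis UN_E Union_iff subsetD)
  qed
  moreover have "(SUP n. emeasure M (\<Union>(A n))) = emeasure M (\<Union>n. \<Union>(A n))"
  proof (rule SUP_emeasure_incseq)
    show "range (\<lambda>n. \<Union>(A n)) \<subseteq> sets M"
    proof (intro image_subsetI sets.finite_Union)
      show "A n \<subseteq> sets M" for n
        using A(2) sets by (rule order_trans)
    qed (use A in auto)
    show "incseq (\<lambda>n. \<Union>(A n))"
      unfolding incseq_def A_def by (intro allI impI Union_mono image_mono) auto
  qed
  ultimately have "c * emeasure M (\<Union>D) = (SUP n. c * emeasure M (\<Union>(A n)))"
    unfolding SUP_mult_left_ennreal[symmetric] by simp
  also have "\<dots> \<le> (\<integral>\<^sup>+ x. h x \<partial>M)"
  proof (rule SUP_least)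
    fix n
    show "c * emeasure M (\<Union>(A n)) \<le> (\<integral>\<^sup>+ x. h x \<partial>M)"
    proof (rule laminar_finite_covering)
      show "laminar (A n)"
        using \<open>laminar D\<close> A(2) by (rule laminar_subset)
      show "A n \<subseteq> sets M"
        using A(2) sets by (rule order_trans)
      show "c * emeasure M Q \<le> (\<integral>\<^sup>+ x\<in>Q. h x \<partial>M)" if "Q \<in> A n" for Q
        using that A(2) le by blast
    qed (use A in auto)
  qed
  finally show ?thesis .
qed simp

text \<open>If the mean of \<open>g\<close> over \<open>Q\<close> exceeds \<open>l\<close>, then the values of \<open>g\<close> below \<open>l / 2\<close> account for at
most half of it. Hence only the part of \<open>g\<close> above \<open>l / 2\<close> is needed on the right, and this
truncation is what makes the integral over \<open>l\<close> in the next theorem converge.\<close>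

lemma maximal_fn_weak_type:
  assumes "countable D" "laminar D" and sets: "D \<subseteq> sets M"
    and [measurable]: "g \<in> borel_measurable M" and l: "0 < l"
  shows "ennreal l * emeasure M {x \<in> space M. ennreal l < maximal_fn M D g x}
    \<le> 2 * (\<integral>\<^sup>+ x. g x * indicator {x. ennreal (l / 2) < g x} x \<partial>M)"
proof -
  define E where "E = {Q \<in> D. ennreal l < (\<integral>\<^sup>+ y\<in>Q. g y \<partial>M) / emeasure M Q}"
  define h where "h x = g x * indicator {x. ennreal (l / 2) < g x} x" for x
  have [measurable]: "h \<in> borel_measurable M"
    unfolding h_def indicator_def by measurable
  have "{x \<in> space M. ennreal l < maximal_fn M D g x} = \<Union>E"
  proof (intro set_eqI iffI)
    fix x assume "x \<in> {x \<in> space M. ennreal l < maximal_fn M D g x}"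
    then obtain Q where "Q \<in> D" "ennreal l < indicator Q x * ((\<integral>\<^sup>+ y\<in>Q. g y \<partial>M) / emeasure M Q)"
      by (auto simp: maximal_fn_def less_SUP_iff)
    then show "x \<in> \<Union>E"
      by (cases "x \<in> Q") (auto simp: E_def)
  next
    fix x assume "x \<in> \<Union>E"
    then obtain Q where Q: "Q \<in> D" "x \<in> Q" "ennreal l < (\<integral>\<^sup>+ y\<in>Q. g y \<partial>M) / emeasure M Q"
      by (auto simp: E_def)
    then show "x \<in> {x \<in> space M. ennreal l < maximal_fn M D g x}"
      using average_le_maximal_fn[OF Q(1,2), of M g] sets sets.sets_into_space[of Q M] by auto
  qed
  moreover have *: "ennreal (l / 2) * emeasure M (\<Union>E) \<le> (\<integral>\<^sup>+ x. h x \<partial>M)"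
  proof (rule laminar_covering)
    fix Q assume "Q \<in> E"
    then have [measurable]: "Q \<in> sets M" and Q: "ennreal l < (\<integral>\<^sup>+ y\<in>Q. g y \<partial>M) / emeasure M Q"
      using sets by (auto simp: E_def)
    have "emeasure M Q \<noteq> top"
      using Q by (metis ennreal_divide_top not_less_zero)
    then obtain r where r: "emeasure M Q = ennreal r" "0 \<le> r"
      by (cases "emeasure M Q") auto
    have "ennreal l * emeasure M Q \<le> (\<integral>\<^sup>+ y\<in>Q. g y \<partial>M)"
    proof (cases "r = 0")
      case False
      then show ?thesis
        using Q r divide_less_ennreal[of "emeasure M Q" "\<integral>\<^sup>+ y\<in>Q. g y \<partial>M" "ennreal l"]
        by (metis ennreal_eq_0_iff ennreal_less_top leI less_le_not_le order_le_less)
    qed (simp add: r)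
    also have "\<dots> \<le> (\<integral>\<^sup>+ y. h y * indicator Q y + ennreal (l / 2) * indicator Q y \<partial>M)"
      by (intro nn_integral_mono) (auto simp: h_def not_less split: split_indicator)
    also have "\<dots> = (\<integral>\<^sup>+ y\<in>Q. h y \<partial>M) + ennreal (l / 2) * emeasure M Q"
      by (simp add: nn_integral_add nn_integral_cmult_indicator)
    also have "\<dots> = (\<integral>\<^sup>+ y\<in>Q. h y \<partial>M) + ennreal (l / 2 * r)"
      using l r ennreal_mult[of "l / 2" r] by simp
    also have "ennreal l * emeasure M Q = ennreal (l * r)"
      using l r ennreal_mult[of l r] by simp
    finally have *: "ennreal (l * r) \<le> (\<integral>\<^sup>+ y\<in>Q. h y \<partial>M) + ennreal (l / 2 * r)" .
    have "ennreal (l / 2 * r) \<le> (\<integral>\<^sup>+ y\<in>Q. h y \<partial>M)"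
    proof (cases "\<integral>\<^sup>+ y\<in>Q. h y \<partial>M")
      case (real s)
      then have "ennreal (l * r) \<le> ennreal (s + l / 2 * r)"
        using * l r real by (subst ennreal_plus) auto
      then have "l * r \<le> s + l / 2 * r"
        using l r real by (subst (asm) ennreal_le_iff) auto
      then show ?thesis
        using real by (auto intro: ennreal_leI)
    qed simp
    then show "ennreal (l / 2) * emeasure M Q \<le> (\<integral>\<^sup>+ y\<in>Q. h y \<partial>M)"
      using l r ennreal_mult[of "l / 2" r] by simp
  qed (use assms in \<open>auto simp: E_def intro: laminar_subset\<close>)
  moreover from * have "2 * (ennreal (l / 2) * emeasure M (\<Union>E)) \<le> 2 * (\<integral>\<^sup>+ x. h x \<partial>M)"
    by (rule mult_left_mono) simp
  moreover have "2 * (ennreal (l / 2) * emeasure M (\<Union>E)) = ennreal l * emeasure M (\<Union>E)"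
    using l ennreal_mult[of 2 "l / 2"] by (simp flip: mult.assoc)
  ultimately show ?thesis
    by (simp only: h_def)
qed

definition doob_const :: "real \<Rightarrow> real" where
  "doob_const p = p * 2 powr p / (p - 1)"

lemma doob_const_pos: "1 < p \<Longrightarrow> 0 < doob_const p"
  by (simp add: doob_const_def)

text \<open>Doob's maximal inequality: multiply the weak type estimate by \<open>p l powr (p - 2)\<close>, integrate
over \<open>l\<close>, and exchange the integrals. The constant depends on \<open>p\<close> alone, neither on the family nor
on the measure.\<close>

theorem maximal_fn_strong_type:
  assumes "sigma_finite_measure M" "countable D" "laminar D" and sets: "D \<subseteq> sets M"
    and [measurable]: "g \<in> borel_measurable M" and p: "1 < p"
  shows "(\<integral>\<^sup>+ x. maximal_fn M D g x epowr p \<partial>M)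
    \<le> ennreal (doob_const p) * (\<integral>\<^sup>+ x. g x epowr p \<partial>M)"
proof -
  interpret M: sigma_finite_measure M by fact
  interpret pair_sigma_finite lborel M ..
  note [measurable] = measurable_maximal_fn[OF assms(2) sets]
  let ?u = "\<lambda>l. ennreal (p * l powr (p - 1))"
  let ?v = "\<lambda>l. ennreal (2 * p * l powr (p - 2))"
  have "(\<integral>\<^sup>+ x. maximal_fn M D g x epowr p \<partial>M)
      = (\<integral>\<^sup>+ x. \<integral>\<^sup>+ l. indicator {l. 0 < l \<and> ennreal l < maximal_fn M D g x} l * ?u l \<partial>lborel \<partial>M)"
    using p by (simp add: epowr_layer_cake)
  also have "\<dots> = (\<integral>\<^sup>+ l. \<integral>\<^sup>+ x. indicator {l. 0 < l \<and> ennreal l < maximal_fn M D g x} l * ?u l \<partial>M \<partial>lborel)"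
    by (rule Fubini'[of "\<lambda>l x. indicator {l. 0 < l \<and> ennreal l < maximal_fn M D g x} l * ?u l"])
      (unfold indicator_def, measurable)
  also have "\<dots> \<le> (\<integral>\<^sup>+ l. \<integral>\<^sup>+ x. g x * (indicator {l. 0 < l \<and> ennreal l < 2 * g x} l * ?v l) \<partial>M \<partial>lborel)"
  proof (rule nn_integral_mono)
    fix l :: real
    show "(\<integral>\<^sup>+ x. indicator {l. 0 < l \<and> ennreal l < maximal_fn M D g x} l * ?u l \<partial>M)
      \<le> (\<integral>\<^sup>+ x. g x * (indicator {l. 0 < l \<and> ennreal l < 2 * g x} l * ?v l) \<partial>M)"
    proof (cases "0 < l")
      case l: True
      have half: "ennreal (l / 2) < y \<longleftrightarrow> ennreal l < 2 * y" for y
      proof (cases y)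
        case (real r)
        then have "2 * y = ennreal (2 * r)" by (simp add: ennreal_mult')
        then show ?thesis using real l by (auto simp: ennreal_less_iff)
      qed (simp add: ennreal_mult_top)
      have "?u l = ennreal (p * l powr (p - 2)) * ennreal l"
        using l p by (simp add: powr_mult_base mult_ac flip: ennreal_mult) 
      have "(\<integral>\<^sup>+ x. indicator {l. 0 < l \<and> ennreal l < maximal_fn M D g x} l * ?u l \<partial>M)
        = (\<integral>\<^sup>+ x. ?u l * indicator {x \<in> space M. ennreal l < maximal_fn M D g x} x \<partial>M)"
        using l by (intro nn_integral_cong) (auto split: split_indicator)
      also have "\<dots> = ennreal (p * l powr (p - 2)) * (ennreal l * emeasure M {x \<in> space M. ennreal l < maximal_fn M D g x})"
        by (subst nn_integral_cmult_indicator) (auto simp: \<open>?u l = _\<close> mult_ac)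
      also have "\<dots> \<le> ennreal (p * l powr (p - 2)) * (2 * (\<integral>\<^sup>+ x. g x * indicator {x. ennreal (l / 2) < g x} x \<partial>M))"
        using assms l by (intro mult_left_mono maximal_fn_weak_type) auto
      also have "\<dots> = ?v l * (\<integral>\<^sup>+ x. g x * indicator {x. ennreal l < 2 * g x} x \<partial>M)"
        using p by (simp add: half ennreal_mult' mult_ac flip: ennreal_numeral)
      also have "\<dots> = (\<integral>\<^sup>+ x. ?v l * (g x * indicator {x. ennreal l < 2 * g x} x) \<partial>M)"
        unfolding indicator_def by (rule nn_integral_cmult[symmetric]) measurable
      also have "\<dots> = (\<integral>\<^sup>+ x. g x * (indicator {l. 0 < l \<and> ennreal l < 2 * g x} l * ?v l) \<partial>M)"
        using l by (intro nn_integral_cong) (auto simp: mult_ac split: split_indicator)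
      finally show ?thesis .
    qed simp
  qed
  also have "\<dots> = (\<integral>\<^sup>+ x. \<integral>\<^sup>+ l. g x * (indicator {l. 0 < l \<and> ennreal l < 2 * g x} l * ?v l) \<partial>lborel \<partial>M)"
    by (rule Fubini'[of "\<lambda>l x. g x * (indicator {l. 0 < l \<and> ennreal l < 2 * g x} l * ?v l)", symmetric])
      (unfold indicator_def, measurable)
  also have "\<dots> = (\<integral>\<^sup>+ x. ennreal (p * 2 powr p / (p - 1)) * g x epowr p \<partial>M)"
  proof (rule nn_integral_cong)
    fix x
    have v: "?v l = ennreal (2 * p / (p - 1)) * ennreal ((p - 1) * l powr (p - 1 - 1))" for l
      using p by (simp flip: ennreal_mult)
    have "(\<integral>\<^sup>+ l. g x * (indicator {l. 0 < l \<and> ennreal l < 2 * g x} l * ?v l) \<partial>lborel)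
      = (\<integral>\<^sup>+ l. (g x * ennreal (2 * p / (p - 1))) * (indicator {l. 0 < l \<and> ennreal l < 2 * g x} l * ennreal ((p - 1) * l powr (p - 1 - 1))) \<partial>lborel)"
      unfolding v by (simp add: mult_ac)
    also have "\<dots> = (g x * ennreal (2 * p / (p - 1))) * (2 * g x) epowr (p - 1)"
      using p by (subst nn_integral_cmult) (simp_all add: epowr_layer_cake[of "p - 1" "2 * g x"] indicator_def)
    also have "\<dots> = ennreal (2 * p / (p - 1)) * 2 epowr (p - 1) * (g x epowr 1 * g x epowr (p - 1))"
      using p by (simp only: epowr_mult epowr_1 mult_ac)
    also have "g x epowr 1 * g x epowr (p - 1) = g x epowr p"
      using epowr_add[of "g x" 1 "p - 1"] by simp
    also have "2 epowr (p - 1) = ennreal (2 powr (p - 1))"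
      using epowr_ennreal[of 2 "p - 1"] by simp
    also have "ennreal (2 * p / (p - 1)) * ennreal (2 powr (p - 1)) = ennreal (2 * p / (p - 1) * 2 powr (p - 1))"
      using p by (intro ennreal_mult[symmetric]) auto
    also have "2 * p / (p - 1) * 2 powr (p - 1) = p * 2 powr p / (p - 1)"
      using powr_mult_base[of 2 "p - 1"] by simp
    finally show "(\<integral>\<^sup>+ l. g x * (indicator {l. 0 < l \<and> ennreal l < 2 * g x} l * ?v l) \<partial>lborel)
      = ennreal (p * 2 powr p / (p - 1)) * g x epowr p" .
  qed
  also have "\<dots> = ennreal (p * 2 powr p / (p - 1)) * (\<integral>\<^sup>+ x. g x epowr p \<partial>M)"
    by (rule nn_integral_cmult) measurable
  finally show ?thesis
    by (simp add: doob_const_def)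
qed

section \<open>Muckenhoupt's theorem for a laminar family\<close>

lemma set_nn_integral_pos:
  fixes w :: "'a \<Rightarrow> real"
  assumes [measurable]: "w \<in> borel_measurable M" "Q \<in> sets M" and "\<And>x. 0 < w x" and "emeasure M Q \<noteq> 0"
  shows "(\<integral>\<^sup>+ x\<in>Q. ennreal (w x) \<partial>M) \<noteq> 0"
proof
  assume "(\<integral>\<^sup>+ x\<in>Q. ennreal (w x) \<partial>M) = 0"
  then have "AE x in M. ennreal (w x) * indicator Q x = 0"
    by (subst (asm) nn_integral_0_iff_AE) auto
  then have "AE x in M. x \<notin> Q"
  proof eventually_elim
    case (elim x)
    then show ?case
      using assms(3)[of x] by (auto simp: indicator_def split: if_splits)
  qed
  then have "emeasure M Q = 0"
    by (subst (asm) AE_iff_measurable[OF assms(2)]) (use sets.sets_into_space[OF assms(2)] in auto)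
  then show False using assms by simp
qed

text \<open>Muckenhoupt's condition \<open>A\<^sub>p\<close>, multiplied out so that no mean value has to be formed. The power
\<open>1 / (1 - p)\<close> is \<open>1 - p'\<close> for the conjugate exponent \<open>p'\<close>, so the second integral is that of the
dual weight.\<close>

definition Ap_weight :: "'a measure \<Rightarrow> 'a set set \<Rightarrow> real \<Rightarrow> real \<Rightarrow> ('a \<Rightarrow> real) \<Rightarrow> bool" where
  "Ap_weight M D p A w \<longleftrightarrow> w \<in> borel_measurable M \<and> (\<forall>x. 0 < w x) \<and>
    (\<forall>Q\<in>D. (\<integral>\<^sup>+ x\<in>Q. w x \<partial>M) * (\<integral>\<^sup>+ x\<in>Q. w x powr (1 / (1 - p)) \<partial>M) epowr (p - 1)
      \<le> ennreal A * emeasure M Q epowr p)"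

text \<open>Here \<open>V\<close>, \<open>W\<close> and \<open>S\<close> stand for the measures of a cube \<open>Q\<close> with respect to \<open>dx\<close>, \<open>w dx\<close> and the
dual weight \<open>s dx\<close>, and \<open>F\<close> for the integral of \<open>f\<close> over \<open>Q\<close>. The mean \<open>F / V\<close> equals
\<open>(F / S) (S / V)\<close>; its first factor is a mean of \<open>f / s\<close> with respect to \<open>s dx\<close>, and the \<open>A\<^sub>p\<close>
condition trades the second one for \<open>V / W\<close>.\<close>

lemma Ap_average_bound:
  fixes F J :: ennreal and A p :: real
  assumes p: "1 < p" and A: "0 < A" and Q: "V \<noteq> 0" "V \<noteq> top" and w: "W \<noteq> 0" and S: "S \<noteq> 0"
    and le: "W * S epowr (p - 1) \<le> ennreal A * V epowr p"
    and J: "V * (F / S) epowr (p - 1) \<le> J"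
  shows "(F / V) epowr (p - 1) \<le> ennreal A * (J / W)"
proof -
  have "ennreal A * V epowr p \<noteq> top"
    using Q by (simp add: ennreal_mult_eq_top_iff)
  then have fin: "W * S epowr (p - 1) \<noteq> top"
    using le by (metis top_unique)
  have "W \<noteq> top" "S \<noteq> top"
    using fin w S by (auto simp: ennreal_mult_eq_top_iff)
  obtain v where v: "V = ennreal v" "0 < v"
    using Q by (cases V) (auto simp: less_le)
  obtain x where x: "W = ennreal x" "0 < x"
    using \<open>W \<noteq> top\<close> w by (cases W) (auto simp: less_le)
  obtain y where y: "S = ennreal y" "0 < y"
    using \<open>S \<noteq> top\<close> S by (cases S) (auto simp: less_le)
  have "x * y powr (p - 1) \<le> A * v powr p"
    using le v x y A by (simp add: epowr_ennreal flip: ennreal_mult)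
  then have "x * y powr (p - 1) \<le> (A * v) * v powr (p - 1)"
    using v powr_mult_base[of v "p - 1"] by (simp add: mult.assoc)
  then have "(1 / v) powr (p - 1) \<le> A * v * (1 / y) powr (p - 1) * (1 / x)"
    using v x y by (simp add: powr_divide field_simps)
  then have "F epowr (p - 1) * ennreal ((1 / v) powr (p - 1))
    \<le> F epowr (p - 1) * ennreal (A * v * (1 / y) powr (p - 1) * (1 / x))"
    by (intro mult_left_mono ennreal_leI) auto
  also have "\<dots> = ennreal A * ((V * (F / S) epowr (p - 1)) * ennreal (1 / x))"
  proof -
    have "ennreal (a * b * c * d) = ennreal a * ennreal b * ennreal c * ennreal d"
      if "0 \<le> a" "0 \<le> b" "0 \<le> c" "0 \<le> d" for a b c d
      using that by (simp add: ennreal_mult)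
    from this[of A v "(1 / y) powr (p - 1)" "1 / x"]
    have "ennreal (A * v * (1 / y) powr (p - 1) * (1 / x))
        = ennreal A * ennreal v * ennreal ((1 / y) powr (p - 1)) * ennreal (1 / x)"
      using A v x y by (simp only: less_imp_le powr_ge_zero divide_nonneg_pos zero_le_one)
    then show ?thesis
      using p v x y by (simp only: divide_ennreal_eq_mult epowr_mult epowr_ennreal) (simp add: epowr_mult epowr_ennreal mult_ac)
  qed
  also have "\<dots> \<le> ennreal A * (J / W)"
    using J x by (simp add: divide_ennreal_eq_mult mult_left_mono mult_right_mono)
  finally show ?thesis
    using v p by (simp add: divide_ennreal_eq_mult epowr_mult epowr_ennreal)
qed

text \<open>Lerner's proof of Muckenhoupt's theorem. Let \<open>s\<close> be the dual weight and let \<open>M\<^sub>w\<close>, \<open>M\<^sub>s\<close> be the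
maximal functions with respect to \<open>w dx\<close> and \<open>s dx\<close>. The \<open>A\<^sub>p\<close> condition gives the pointwise bound
\<open>(M f)\<^bsup>p-1\<^esup> \<le> A M\<^sub>w (M\<^sub>s (f / s)\<^bsup>p-1\<^esup> / w)\<close>. The assertion follows from Doob's inequality for \<open>M\<^sub>w\<close> with
exponent \<open>p'\<close> and then for \<open>M\<^sub>s\<close> with exponent \<open>p\<close>; the powers of \<open>w\<close> and \<open>s\<close> match because
\<open>w\<^bsup>1-p'\<^esup> = s\<close> and \<open>s\<^bsup>1-p\<^esup> = w\<close>.\<close>

theorem muckenhoupt_laminar:
  assumes M: "sigma_finite_measure M" and D: "countable D" "laminar D" "D \<subseteq> sets M"
    and pos: "\<And>Q. Q \<in> D \<Longrightarrow> emeasure M Q \<noteq> 0" and fin: "\<And>Q. Q \<in> D \<Longrightarrow> emeasure M Q \<noteq> top"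
    and p: "1 < p" and A: "0 < A" and w: "Ap_weight M D p A w"
    and f [measurable]: "f \<in> borel_measurable M"
  shows "(\<integral>\<^sup>+ x. maximal_fn M D f x epowr p * w x \<partial>M)
    \<le> ennreal (A powr (p / (p - 1)) * doob_const (p / (p - 1)) * doob_const p) * (\<integral>\<^sup>+ x. f x epowr p * w x \<partial>M)"
proof -
  define s where "s x = w x powr (1 / (1 - p))" for x
  define p' where "p' = p / (p - 1)"
  define Mw where "Mw = density M w"
  define Ms where "Ms = density M s"
  have [measurable]: "w \<in> borel_measurable M" and w0: "\<And>x. 0 < w x"
    using w by (auto simp: Ap_weight_def)
  have [measurable]: "s \<in> borel_measurable M"
    unfolding s_def by measurable
  have s0: "0 < s x" for x
    using w0[of x] by (simp add: s_def)
  have p': "1 < p'" "(p - 1) * p' = p"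
    using p by (auto simp: p'_def field_simps)
  have sets_eq [simp]: "sets Mw = sets M" "sets Ms = sets M"
    by (auto simp: Mw_def Ms_def)
  have [measurable_cong]: "sets Mw = sets M" "sets Ms = sets M"
    by simp_all
  have sf: "sigma_finite_measure Mw" "sigma_finite_measure Ms"
    using w0 s0 by (auto simp: Mw_def Ms_def intro!: sigma_finite_measure.sigma_finite_iff_density_finite[OF M, THEN iffD2])
  have int_w: "(\<integral>\<^sup>+ x. h x \<partial>Mw) = (\<integral>\<^sup>+ x. h x * w x \<partial>M)"
    and int_s: "(\<integral>\<^sup>+ x. h x \<partial>Ms) = (\<integral>\<^sup>+ x. h x * s x \<partial>M)"
    if [measurable]: "h \<in> borel_measurable M" for h
    unfolding Mw_def Ms_def by (simp_all add: nn_integral_density mult.commute)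
  define h where "h x = f x / ennreal (s x)" for x
  define g where "g x = maximal_fn Ms D h x epowr (p - 1) / ennreal (w x)" for x
  have [measurable]: "maximal_fn Ms D h \<in> borel_measurable M" "maximal_fn Mw D g \<in> borel_measurable M"
    using measurable_maximal_fn[of D Ms h] measurable_maximal_fn[of D Mw g] D
    by (simp_all cong: measurable_cong_sets)
  have [measurable]: "h \<in> borel_measurable M"
    unfolding h_def by measurable
  have [measurable]: "g \<in> borel_measurable M"
    unfolding g_def by measurable
  have cancel: "a / ennreal b * ennreal b = a" if "0 < b" for a b
    using that by (simp add: ennreal_divide_times)
  have ptw: "maximal_fn M D f x epowr (p - 1) \<le> ennreal A * maximal_fn Mw D g x" for x
  proof -
    have "(\<integral>\<^sup>+ y\<in>Q. f y \<partial>M) / emeasure M Q \<le> (ennreal A * maximal_fn Mw D g x) epowr (1 / (p - 1))"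
      if Q: "Q \<in> D" "x \<in> Q" for Q
    proof -
      have [measurable]: "Q \<in> sets M" using Q D by auto
      have avg_s: "(\<integral>\<^sup>+ y\<in>Q. f y \<partial>M) / emeasure Ms Q \<le> maximal_fn Ms D h y" if "y \<in> Q" for y
      proof -
        have "(\<integral>\<^sup>+ y\<in>Q. h y \<partial>Ms) = (\<integral>\<^sup>+ y\<in>Q. f y \<partial>M)"
          using s0 by (subst int_s) (auto simp: h_def cancel mult.assoc mult.left_commute[of _ "indicator _ _"] mult.commute[of _ "indicator _ _"] intro!: nn_integral_cong)
        then show ?thesis
          using average_le_maximal_fn[OF Q(1) that, of Ms h] by simp
      qed
      have "emeasure M Q * ((\<integral>\<^sup>+ y\<in>Q. f y \<partial>M) / emeasure Ms Q) epowr (p - 1)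
          = (\<integral>\<^sup>+ y. ((\<integral>\<^sup>+ y\<in>Q. f y \<partial>M) / emeasure Ms Q) epowr (p - 1) * indicator Q y \<partial>M)"
        by (subst nn_integral_cmult_indicator) (simp_all add: mult.commute)
      also have "\<dots> \<le> (\<integral>\<^sup>+ y. g y * indicator Q y * w y \<partial>M)"
        using avg_s p w0 by (intro nn_integral_mono) (auto simp: g_def cancel intro!: epowr_mono split: split_indicator)
      also have "\<dots> = (\<integral>\<^sup>+ y\<in>Q. g y \<partial>Mw)"
        by (rule int_w[symmetric]) measurable
      finally have *: "emeasure M Q * ((\<integral>\<^sup>+ y\<in>Q. f y \<partial>M) / emeasure Ms Q) epowr (p - 1) \<le> (\<integral>\<^sup>+ y\<in>Q. g y \<partial>Mw)" .
      have em: "emeasure Mw Q = (\<integral>\<^sup>+ x\<in>Q. w x \<partial>M)" "emeasure Ms Q = (\<integral>\<^sup>+ x\<in>Q. s x \<partial>M)"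
        unfolding Mw_def Ms_def by (simp_all add: emeasure_density)
      have "((\<integral>\<^sup>+ y\<in>Q. f y \<partial>M) / emeasure M Q) epowr (p - 1) \<le> ennreal A * ((\<integral>\<^sup>+ y\<in>Q. g y \<partial>Mw) / emeasure Mw Q)"
      proof (rule Ap_average_bound[OF p A pos[OF Q(1)] fin[OF Q(1)] _ _ _ *])
        show "emeasure Mw Q \<noteq> 0" "emeasure Ms Q \<noteq> 0"
          unfolding em using pos[OF Q(1)] w0 s0 by (intro set_nn_integral_pos; simp)+
        show "emeasure Mw Q * emeasure Ms Q epowr (p - 1) \<le> ennreal A * emeasure M Q epowr p"
          unfolding em s_def using w Q by (auto simp: Ap_weight_def)
      qed
      also have "\<dots> \<le> ennreal A * maximal_fn Mw D g x"
        by (intro mult_left_mono average_le_maximal_fn Q) simp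
      finally show ?thesis
        using p by (simp add: epowr_le_iff)
    qed
    then have "maximal_fn M D f x \<le> (ennreal A * maximal_fn Mw D g x) epowr (1 / (p - 1))"
      by (rule maximal_fn_leI)
    then show ?thesis
      using p by (simp add: epowr_le_iff)
  qed
  have w_s: "(1 / w x) powr p' * w x = s x" for x
  proof -
    have "(1 / w x) powr p' * w x = w x powr (1 + - p')"
      using w0[of x] by (simp only: powr_add powr_one powr_divide powr_minus) (simp add: field_simps)
    also have "1 + - p' = 1 / (1 - p)"
      using p by (simp add: p'_def field_simps)
    finally show ?thesis by (simp add: s_def)
  qed
  have s_w: "(1 / s x) powr p * s x = w x" for x
  proof -
    have "(1 / s x) powr p * s x = s x powr (1 + - p)"
      using s0[of x] by (simp only: powr_add powr_one powr_divide powr_minus) (simp add: field_simps)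
    also have "\<dots> = w x"
      using p w0[of x] by (simp add: s_def powr_powr)
    finally show ?thesis .
  qed
  have "(\<integral>\<^sup>+ x. maximal_fn M D f x epowr p * w x \<partial>M)
      \<le> (\<integral>\<^sup>+ x. ennreal (A powr p') * (maximal_fn Mw D g x epowr p' * w x) \<partial>M)"
  proof (rule nn_integral_mono)
    fix x
    have "maximal_fn M D f x epowr p = (maximal_fn M D f x epowr (p - 1)) epowr p'"
      using p' by simp
    also have "\<dots> \<le> (ennreal A * maximal_fn Mw D g x) epowr p'"
      using p' by (intro epowr_mono ptw) simp
    also have "\<dots> = ennreal (A powr p') * maximal_fn Mw D g x epowr p'"
      using A p' by (simp add: epowr_mult epowr_ennreal)
    finally show "maximal_fn M D f x epowr p * w x \<le> ennreal (A powr p') * (maximal_fn Mw D g x epowr p' * w x)"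
      by (simp add: mult_right_mono flip: mult.assoc)
  qed
  also have "\<dots> = ennreal (A powr p') * (\<integral>\<^sup>+ x. maximal_fn Mw D g x epowr p' \<partial>Mw)"
    by (simp add: nn_integral_cmult int_w)
  also have "\<dots> \<le> ennreal (A powr p') * (ennreal (doob_const p') * (\<integral>\<^sup>+ x. g x epowr p' \<partial>Mw))"
    using sf D p' by (intro mult_left_mono maximal_fn_strong_type) auto
  also have "(\<integral>\<^sup>+ x. g x epowr p' \<partial>Mw) = (\<integral>\<^sup>+ x. maximal_fn Ms D h x epowr p * s x \<partial>M)"
  proof -
    have "g x epowr p' * w x = maximal_fn Ms D h x epowr p * s x" for x
    proof -
      have "g x epowr p' * w x = maximal_fn Ms D h x epowr ((p - 1) * p') * ennreal ((1 / w x) powr p' * w x)"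
        using w0[of x] p' by (simp add: g_def divide_ennreal_eq_mult epowr_mult epowr_ennreal ennreal_mult mult_ac)
      then show ?thesis
        by (simp only: w_s p')
    qed
    then show ?thesis
      by (simp add: int_w)
  qed
  also have "\<dots> = (\<integral>\<^sup>+ x. maximal_fn Ms D h x epowr p \<partial>Ms)"
    by (simp add: int_s)
  also have "\<dots> \<le> ennreal (doob_const p) * (\<integral>\<^sup>+ x. h x epowr p \<partial>Ms)"
    using sf D p by (intro maximal_fn_strong_type) auto
  also have "(\<integral>\<^sup>+ x. h x epowr p \<partial>Ms) = (\<integral>\<^sup>+ x. f x epowr p * w x \<partial>M)"
  proof -
    have "h x epowr p * s x = f x epowr p * w x" for x
    proof -
      have "h x epowr p * s x = f x epowr p * ennreal ((1 / s x) powr p * s x)"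
        using s0[of x] p by (simp add: h_def divide_ennreal_eq_mult epowr_mult epowr_ennreal ennreal_mult mult_ac)
      then show ?thesis
        by (simp only: s_w)
    qed
    then show ?thesis
      by (simp add: int_s)
  qed
  finally show ?thesis
    using A p p' by (simp add: ennreal_mult doob_const_pos less_imp_le mult_left_mono mult.assoc flip: p'_def)
qed

section \<open>Quotients of weights of class \<open>A\<^sub>1\<close>\<close>

text \<open>The condition \<open>M w \<le> c w\<close> almost everywhere, asked for one member of \<open>D\<close> at a time.\<close>

definition A1_weight :: "'a measure \<Rightarrow> 'a set set \<Rightarrow> real \<Rightarrow> ('a \<Rightarrow> real) \<Rightarrow> bool" where
  "A1_weight M D c w \<longleftrightarrow> w \<in> borel_measurable M \<and> (\<forall>x. 0 < w x) \<and>
    (\<forall>Q\<in>D. AE x in M. x \<in> Q \<longrightarrow> (\<integral>\<^sup>+ y\<in>Q. w y \<partial>M) / emeasure M Q \<le> ennreal (c * w x))"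

lemma A1_weight_subset: "A1_weight M D c w \<Longrightarrow> E \<subseteq> D \<Longrightarrow> A1_weight M E c w"
  unfolding A1_weight_def by blast

lemma A1_weight_mono:
  assumes "A1_weight M D c w" "c \<le> d"
  shows "A1_weight M D d w"
  unfolding A1_weight_def
proof (intro conjI ballI)
  fix Q assume "Q \<in> D"
  then have "AE x in M. x \<in> Q \<longrightarrow> (\<integral>\<^sup>+ y\<in>Q. w y \<partial>M) / emeasure M Q \<le> ennreal (c * w x)"
    using assms by (auto simp: A1_weight_def)
  then show "AE x in M. x \<in> Q \<longrightarrow> (\<integral>\<^sup>+ y\<in>Q. w y \<partial>M) / emeasure M Q \<le> ennreal (d * w x)"
  proof eventually_elim
    case (elim x)
    have "ennreal (c * w x) \<le> ennreal (d * w x)"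
      using assms by (intro ennreal_leI mult_right_mono) (auto simp: A1_weight_def less_imp_le)
    with elim show ?case by (auto intro: order_trans)
  qed
qed (use assms in \<open>auto simp: A1_weight_def\<close>)

text \<open>Since \<open>w\<close> has finite values, the \<open>A\<^sub>1\<close> condition at one point of \<open>Q\<close> already makes its mean over \<open>Q\<close>
finite.\<close>

lemma A1_weight_average:
  assumes w: "A1_weight M D c w" and Q: "Q \<in> D" "Q \<in> sets M" "emeasure M Q \<noteq> 0" "emeasure M Q \<noteq> top"
  obtains a where "0 < a" "(\<integral>\<^sup>+ x\<in>Q. w x \<partial>M) = ennreal a * emeasure M Q" "AE x in M. x \<in> Q \<longrightarrow> a \<le> c * w x"
proof -
  let ?A = "(\<integral>\<^sup>+ x\<in>Q. w x \<partial>M) / emeasure M Q"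
  have [measurable]: "w \<in> borel_measurable M" and w0: "\<And>x. 0 < w x"
    and ae: "AE x in M. x \<in> Q \<longrightarrow> ?A \<le> ennreal (c * w x)"
    using w Q by (auto simp: A1_weight_def)
  have "?A \<noteq> top"
  proof
    assume "?A = top"
    with ae have "AE x in M. x \<notin> Q"
      by (auto simp: top_unique)
    then have "emeasure M Q = 0"
      by (subst (asm) AE_iff_measurable[OF Q(2)]) (use sets.sets_into_space[OF Q(2)] in auto)
    with Q show False by simp
  qed
  moreover have "?A \<noteq> 0"
    using set_nn_integral_pos[of w M Q] w0 Q by simp
  ultimately obtain a where a: "?A = ennreal a" "0 < a"
    by (cases ?A) (auto simp: less_le)
  show ?thesis
  proof
    show "(\<integral>\<^sup>+ x\<in>Q. w x \<partial>M) = ennreal a * emeasure M Q"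
      using Q a by (metis ennreal_divide_times ennreal_divide_self mult.right_neutral not_gr_zero top.not_eq_extremum)
    show "AE x in M. x \<in> Q \<longrightarrow> a \<le> c * w x"
      using ae
    proof eventually_elim
      case (elim x)
      then show ?case
        using a by (auto simp: ennreal_le_iff2)
    qed
  qed fact
qed

text \<open>On \<open>Q\<close> the weight \<open>w2\<close> is at least \<open>a2 / c\<close>, so its negative power can be replaced by a
constant.\<close>

lemma A1_weight_quotient_average:
  fixes w1 w2 :: "'a \<Rightarrow> real"
  assumes w: "w1 \<in> borel_measurable M" "w2 \<in> borel_measurable M" "\<And>x. 0 < w1 x" "\<And>x. 0 < w2 x"
    and a1: "(\<integral>\<^sup>+ x\<in>Q. w1 x \<partial>M) = ennreal a1 * V" "0 < a1"
    and a2: "AE x in M. x \<in> Q \<longrightarrow> a2 \<le> c * w2 x" "0 < a2"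
    and c: "0 < c" and e: "0 < e" and [measurable]: "Q \<in> sets M"
  shows "(\<integral>\<^sup>+ x\<in>Q. w1 x * w2 x powr - e \<partial>M) \<le> ennreal (a1 * (a2 / c) powr - e) * V"
proof -
  note [measurable] = w(1,2)
  have "(\<integral>\<^sup>+ x\<in>Q. w1 x * w2 x powr - e \<partial>M) \<le> (\<integral>\<^sup>+ x. ennreal ((a2 / c) powr - e) * (ennreal (w1 x) * indicator Q x) \<partial>M)"
  proof (rule nn_integral_mono_AE)
    show "AE x in M. ennreal (w1 x * w2 x powr - e) * indicator Q x \<le> ennreal ((a2 / c) powr - e) * (ennreal (w1 x) * indicator Q x)"
      using a2(1)
    proof eventually_elim
      case (elim x)
      show ?case
      proof (cases "x \<in> Q")
        case True
        then have "a2 / c \<le> w2 x"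
          using elim c by (simp add: field_simps)
        then have "w2 x powr - e \<le> (a2 / c) powr - e"
          using a2 c e by (intro powr_mono2') auto
        then have "w1 x * w2 x powr - e \<le> (a2 / c) powr - e * w1 x"
          using w(3)[of x] by (simp add: mult.commute)
        then show ?thesis
          using True w(3)[of x] by (simp add: less_imp_le ennreal_leI flip: ennreal_mult)
      qed simp
    qed
  qed
  also have "\<dots> = ennreal ((a2 / c) powr - e) * (\<integral>\<^sup>+ x\<in>Q. w1 x \<partial>M)"
    by (rule nn_integral_cmult) measurable
  also have "\<dots> = ennreal (a1 * (a2 / c) powr - e) * V"
    using a1 by (simp add: ennreal_mult mult_ac)
  finally show ?thesis .
qed

text \<open>Such quotients of \<open>A\<^sub>1\<close> weights satisfy \<open>A\<^sub>p\<close>, and by the factorization theorem of Jones every \<open>A\<^sub>p\<close> weight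
is one. This is the form in which extrapolation produces its weights.\<close>

definition factored_weight :: "'a measure \<Rightarrow> 'a set set \<Rightarrow> real \<Rightarrow> real \<Rightarrow> ('a \<Rightarrow> real) \<Rightarrow> bool" where
  "factored_weight M D c p w \<longleftrightarrow>
    (\<exists>w1 w2. A1_weight M D c w1 \<and> A1_weight M D c w2 \<and> w = (\<lambda>x. w1 x * w2 x powr (1 - p)))"

lemma factored_weight_pos: "factored_weight M D c p w \<Longrightarrow> 0 < w x"
  unfolding factored_weight_def A1_weight_def by (auto simp: less_le)

lemma factored_weight_measurable: "factored_weight M D c p w \<Longrightarrow> w \<in> borel_measurable M"
  unfolding factored_weight_def A1_weight_def by auto

lemma factored_weight_subset: "factored_weight M D c p w \<Longrightarrow> E \<subseteq> D \<Longrightarrow> factored_weight M E c p w"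
  unfolding factored_weight_def using A1_weight_subset by blast

lemma quotient_powr_dual:
  fixes a b p :: real
  assumes "1 < p" "0 < a" "0 < b"
  shows "(a * b powr (1 - p)) powr (1 / (1 - p)) = b * a powr - (1 / (p - 1))"
proof -
  have "1 / (1 - p) = - (1 / (p - 1))"
    using assms by (simp add: field_simps)
  moreover have "(1 - p) * (1 / (1 - p)) = 1"
    using assms by simp
  ultimately show ?thesis
    using assms by (simp only: powr_mult powr_powr less_imp_le powr_ge_zero powr_one mult.commute)
qed

text \<open>Passing to the dual weight and the conjugate exponent exchanges the two \<open>A\<^sub>1\<close> weights.\<close>

lemma factored_weight_dual:
  assumes w: "factored_weight M D c p w" and p: "1 < p"
  shows "factored_weight M D c (p / (p - 1)) (\<lambda>x. w x powr (1 / (1 - p)))"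
proof -
  obtain w1 w2 where A1: "A1_weight M D c w1" "A1_weight M D c w2"
    and w: "w = (\<lambda>x. w1 x * w2 x powr (1 - p))"
    using w by (auto simp: factored_weight_def)
  have "1 - p / (p - 1) = - (1 / (p - 1))"
    using p by (simp add: field_simps)
  then have "(\<lambda>x. w x powr (1 / (1 - p))) = (\<lambda>x. w2 x * w1 x powr (1 - p / (p - 1)))"
    using A1 p by (auto simp: w quotient_powr_dual A1_weight_def)
  then show ?thesis
    unfolding factored_weight_def using A1 by blast
qed

text \<open>In the product of the two bounds from \<open>A1_weight_quotient_average\<close> the mean values of \<open>w1\<close> and
\<open>w2\<close> cancel.\<close>

lemma factored_weight_Ap:
  assumes w: "factored_weight M D c p w" and p: "1 < p" and c: "0 < c"
    and D: "D \<subseteq> sets M" "\<And>Q. Q \<in> D \<Longrightarrow> emeasure M Q \<noteq> 0" "\<And>Q. Q \<in> D \<Longrightarrow> emeasure M Q \<noteq> top"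
  shows "Ap_weight M D p (c powr p) w"
proof -
  obtain w1 w2 where A1: "A1_weight M D c w1" "A1_weight M D c w2"
    and w_eq: "w = (\<lambda>x. w1 x * w2 x powr (1 - p))"
    using w by (auto simp: factored_weight_def)
  have meas: "w1 \<in> borel_measurable M" "w2 \<in> borel_measurable M" and pos: "\<And>x. 0 < w1 x" "\<And>x. 0 < w2 x"
    using A1 by (auto simp: A1_weight_def)
  have "(\<integral>\<^sup>+ x\<in>Q. w x \<partial>M) * (\<integral>\<^sup>+ x\<in>Q. w x powr (1 / (1 - p)) \<partial>M) epowr (p - 1)
      \<le> ennreal (c powr p) * emeasure M Q epowr p" if QD: "Q \<in> D" for Q
  proof -
    have Q: "Q \<in> sets M" "emeasure M Q \<noteq> 0" "emeasure M Q \<noteq> top"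
      using D that by auto
    obtain a1 where a1: "0 < a1" "(\<integral>\<^sup>+ x\<in>Q. w1 x \<partial>M) = ennreal a1 * emeasure M Q" "AE x in M. x \<in> Q \<longrightarrow> a1 \<le> c * w1 x"
      using A1_weight_average[OF A1(1) QD Q] by blast
    obtain a2 where a2: "0 < a2" "(\<integral>\<^sup>+ x\<in>Q. w2 x \<partial>M) = ennreal a2 * emeasure M Q" "AE x in M. x \<in> Q \<longrightarrow> a2 \<le> c * w2 x"
      using A1_weight_average[OF A1(2) QD Q] by blast
    obtain v where v: "emeasure M Q = ennreal v" "0 < v"
      using Q by (cases "emeasure M Q") (auto simp: less_le)
    have "(\<integral>\<^sup>+ x\<in>Q. w x \<partial>M) \<le> ennreal (a1 * (a2 / c) powr - (p - 1)) * emeasure M Q"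
      using A1_weight_quotient_average[OF meas pos a1(2,1) a2(3,1) c _ Q(1), of "p - 1"] p by (simp add: w_eq)
    moreover have "(\<integral>\<^sup>+ x\<in>Q. w x powr (1 / (1 - p)) \<partial>M) \<le> ennreal (a2 * (a1 / c) powr - (1 / (p - 1))) * emeasure M Q"
      using A1_weight_quotient_average[OF meas(2,1) pos(2,1) a2(2,1) a1(3,1) c _ Q(1), of "1 / (p - 1)"] p pos
      by (simp add: w_eq quotient_powr_dual)
    ultimately have "(\<integral>\<^sup>+ x\<in>Q. w x \<partial>M) * (\<integral>\<^sup>+ x\<in>Q. w x powr (1 / (1 - p)) \<partial>M) epowr (p - 1)
      \<le> (ennreal (a1 * (a2 / c) powr - (p - 1)) * emeasure M Q)
        * (ennreal (a2 * (a1 / c) powr - (1 / (p - 1))) * emeasure M Q) epowr (p - 1)"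
      using p by (intro mult_mono epowr_mono) auto
    also have "\<dots> = ennreal ((a1 * (a2 / c) powr - (p - 1) * v) * (a2 * (a1 / c) powr - (1 / (p - 1)) * v) powr (p - 1))"
      using a1 a2 c v by (simp add: epowr_ennreal flip: ennreal_mult)
    also have "(a1 * (a2 / c) powr - (p - 1) * v) * (a2 * (a1 / c) powr - (1 / (p - 1)) * v) powr (p - 1) = c powr p * v powr p"
    proof -
      have "(a2 * (a1 / c) powr - (1 / (p - 1)) * v) powr (p - 1)
          = a2 powr (p - 1) * (a1 / c) powr - 1 * v powr (p - 1)"
        using a1 a2 c v p by (simp add: powr_mult powr_powr)
      moreover have "(a2 / c) powr - (p - 1) = c powr (p - 1) / a2 powr (p - 1)"
        using a2 c by (simp only: powr_minus powr_divide) simp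
      moreover have "(a1 / c) powr - 1 = c / a1"
        using a1 c by (simp only: powr_minus) (simp add: field_simps)
      moreover have "c powr p = c * c powr (p - 1)" "v powr p = v * v powr (p - 1)"
        using c v powr_mult_base[of c "p - 1"] powr_mult_base[of v "p - 1"] by auto
      ultimately show ?thesis
        using a1 a2 by simp
    qed
    finally show ?thesis
      using v c by (simp add: epowr_ennreal ennreal_mult)
  qed
  then show ?thesis
    unfolding Ap_weight_def using factored_weight_pos[OF w] factored_weight_measurable[OF w] by blast
qed

lemma factored_weight_1:
  assumes "\<And>Q. Q \<in> D \<Longrightarrow> Q \<in> sets M" "1 \<le> c"
  shows "factored_weight M D c p (\<lambda>_. 1)"
proof -
  have "A1_weight M D c (\<lambda>_. 1)"
    unfolding A1_weight_def
  proof (intro conjI ballI AE_I2 impI)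
    fix Q x assume "Q \<in> D"
    then have "(\<integral>\<^sup>+ y\<in>Q. ennreal 1 \<partial>M) / emeasure M Q \<le> 1"
      using assms by (cases "emeasure M Q = 0 \<or> emeasure M Q = top") (auto simp: top.not_eq_extremum)
    also have "1 \<le> ennreal (c * 1)"
      using assms by simp
    finally show "(\<integral>\<^sup>+ y\<in>Q. ennreal 1 \<partial>M) / emeasure M Q \<le> ennreal (c * 1)" .
  qed auto
  then show ?thesis
    unfolding factored_weight_def by (intro exI[of _ "\<lambda>_. 1"]) auto
qed

text \<open>A finite number of laminar families together behave like a single one as far as norm
inequalities are concerned. Several are needed because no single grid of cubes captures all
balls.\<close>

locale grids = sigma_finite_measure M for M :: "'a measure" +
  fixes G :: "'a set set set"
  assumes finite_grids: "finite G"
    and countable_grid: "E \<in> G \<Longrightarrow> countable E"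
    and laminar_grid: "E \<in> G \<Longrightarrow> laminar E"
    and sets_grid: "E \<in> G \<Longrightarrow> E \<subseteq> sets M"
    and grid_nonnull: "E \<in> G \<Longrightarrow> Q \<in> E \<Longrightarrow> emeasure M Q \<noteq> 0"
    and grid_finite: "E \<in> G \<Longrightarrow> Q \<in> E \<Longrightarrow> emeasure M Q \<noteq> top"
begin

abbreviation "mx \<equiv> maximal_fn M (\<Union>G)"
abbreviation "A1 \<equiv> A1_weight M (\<Union>G)"
abbreviation "factored \<equiv> factored_weight M (\<Union>G)"

lemma countable_Union_grids: "countable (\<Union>G)"
proof -
  have "countable (\<Union>E\<in>G. E)"
    using countable_finite[OF finite_grids] countable_grid by (intro countable_UN) auto
  then show ?thesis by simp
qed

lemma measurable_mx [measurable]: "mx f \<in> borel_measurable M"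
  using countable_Union_grids sets_grid by (intro measurable_maximal_fn) auto

text \<open>The power of the joint maximal function is at most the sum of the powers of the maximal
functions of the single grids.\<close>

lemma muckenhoupt_factored:
  assumes p: "1 < p" and c: "0 < c"
  obtains K where "0 < K" "\<And>w f. factored c p w \<Longrightarrow> f \<in> borel_measurable M \<Longrightarrow>
    (\<integral>\<^sup>+ x. mx f x epowr p * w x \<partial>M) \<le> ennreal K * (\<integral>\<^sup>+ x. f x epowr p * w x \<partial>M)"
proof -
  define L where "L = (c powr p) powr (p / (p - 1)) * doob_const (p / (p - 1)) * doob_const p"
  have "1 < p / (p - 1)"
    using p by (simp add: field_simps)
  then have L: "0 < L"
    using p c by (simp add: L_def doob_const_pos)
  show ?thesis
  proof
    show "0 < (real (card G) + 1) * L"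
      using L by (simp add: add_pos_nonneg)
  next
    fix w :: "'a \<Rightarrow> real" and f :: "'a \<Rightarrow> ennreal"
    assume w: "factored c p w" and f [measurable]: "f \<in> borel_measurable M"
    have [measurable]: "w \<in> borel_measurable M"
      using w by (rule factored_weight_measurable)
    have meas [measurable]: "maximal_fn M E f \<in> borel_measurable M" if "E \<in> G" for E
      using that countable_grid sets_grid by (intro measurable_maximal_fn)
    have "(\<integral>\<^sup>+ x. mx f x epowr p * w x \<partial>M) \<le> (\<integral>\<^sup>+ x. (\<Sum>E\<in>G. maximal_fn M E f x epowr p * w x) \<partial>M)"
    proof (rule nn_integral_mono)
      fix x
      have "mx f x \<le> (\<Sum>E\<in>G. maximal_fn M E f x epowr p) epowr (1 / p)"
        unfolding maximal_fn_Union[where D="\<lambda>E. E" and I=G, simplified]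
      proof (rule SUP_least)
        fix E assume "E \<in> G"
        then have "maximal_fn M E f x epowr p \<le> (\<Sum>E\<in>G. maximal_fn M E f x epowr p)"
          using finite_grids by (intro member_le_sum) auto
        then show "maximal_fn M E f x \<le> (\<Sum>E\<in>G. maximal_fn M E f x epowr p) epowr (1 / p)"
          using p by (simp add: epowr_le_iff)
      qed
      then have "mx f x epowr p \<le> (\<Sum>E\<in>G. maximal_fn M E f x epowr p)"
        using p by (simp add: epowr_le_iff)
      then show "mx f x epowr p * w x \<le> (\<Sum>E\<in>G. maximal_fn M E f x epowr p * w x)"
        by (simp add: mult_right_mono flip: sum_distrib_right)
    qed
    also have "\<dots> = (\<Sum>E\<in>G. \<integral>\<^sup>+ x. maximal_fn M E f x epowr p * w x \<partial>M)"
      by (rule nn_integral_sum) (use meas in measurable)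
    also have "\<dots> \<le> (\<Sum>E\<in>G. ennreal L * (\<integral>\<^sup>+ x. f x epowr p * w x \<partial>M))"
      unfolding L_def
    proof (intro sum_mono muckenhoupt_laminar)
      fix E assume E: "E \<in> G"
      show "Ap_weight M E p (c powr p) w"
        using E p c sets_grid grid_nonnull grid_finite
        by (intro factored_weight_Ap factored_weight_subset[OF w]) auto
      show "emeasure M Q \<noteq> 0" "emeasure M Q \<noteq> top" if "Q \<in> E" for Q
        using E that grid_nonnull grid_finite by auto
    qed (use p c countable_grid laminar_grid sets_grid sigma_finite_measure_axioms in auto)
    also have "\<dots> \<le> ennreal ((real (card G) + 1) * L) * (\<integral>\<^sup>+ x. f x epowr p * w x \<partial>M)"
    proof -
      have "of_nat (card G) * ennreal L \<le> ennreal ((real (card G) + 1) * L)"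
        using L by (simp add: ennreal_of_nat_eq_real_of_nat flip: ennreal_mult)
      then show ?thesis
        by (simp add: mult_right_mono flip: mult.assoc)
    qed
    finally show "(\<integral>\<^sup>+ x. mx f x epowr p * w x \<partial>M) \<le> ennreal ((real (card G) + 1) * L) * (\<integral>\<^sup>+ x. f x epowr p * w x \<partial>M)" .
  qed
qed

end

section \<open>The algorithm of Rubio de Francia\<close>

lemma suminf_ennreal_half_powers: "(\<Sum>k. ennreal ((1 / 2) ^ k)) = 2"
proof -
  have "(\<lambda>k. (1 / 2 :: real) ^ k) sums 2"
    using geometric_sums[of "1 / 2 :: real"] by simp
  then have "(\<Sum>k. ennreal ((1 / 2) ^ k)) = ennreal 2"
    by (intro suminf_ennreal_eq) auto
  then show ?thesis by simp
qed

text \<open>A substitute for Minkowski's inequality: \<open>b k\<close> is at most the \<open>l\<^sup>p\<close> norm of the sequence, and the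
geometric factors are summable. The loss is harmless where terms can be made to decay
geometrically.\<close>

lemma suminf_half_epowr_le:
  fixes b :: "nat \<Rightarrow> ennreal"
  assumes p: "0 < p"
  shows "(\<Sum>k. ennreal ((1 / 2) ^ k) * b k) epowr p \<le> ennreal (2 powr p) * (\<Sum>k. b k epowr p)"
proof -
  have b: "b k \<le> (\<Sum>k. b k epowr p) epowr (1 / p)" for k
  proof -
    have "b k epowr p \<le> (\<Sum>k. b k epowr p)"
      using sum_le_suminf[of "\<lambda>k. b k epowr p" "{k}"] by simp
    then show ?thesis
      using p by (simp add: epowr_le_iff)
  qed
  have "(\<Sum>k. ennreal ((1 / 2) ^ k) * b k) \<le> (\<Sum>k. ennreal ((1 / 2) ^ k) * (\<Sum>k. b k epowr p) epowr (1 / p))"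
    using b by (intro suminf_le mult_left_mono) auto
  also have "\<dots> = 2 * (\<Sum>k. b k epowr p) epowr (1 / p)"
    by (simp add: suminf_ennreal_half_powers)
  finally have "(\<Sum>k. ennreal ((1 / 2) ^ k) * b k) epowr p \<le> (2 * (\<Sum>k. b k epowr p) epowr (1 / p)) epowr p"
    using p by (intro epowr_mono) auto
  also have "\<dots> = ennreal (2 powr p) * (\<Sum>k. b k epowr p)"
    using p epowr_ennreal[of 2 p] by (simp add: epowr_mult)
  finally show ?thesis .
qed

text \<open>If \<open>x > u\<close>, then \<open>x\<close> is at most \<open>x (x / u)\<^bsup>p-1\<^esup>\<close>.\<close>

lemma le_epowr_split:
  fixes u :: real
  assumes "0 < u" "1 < p"
  shows "x \<le> x epowr p * ennreal (u powr (1 - p)) + ennreal u"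
proof (cases "x \<le> ennreal u")
  case False
  then have "1 * x \<le> (x epowr (p - 1) * ennreal (u powr (1 - p))) * x"
  proof (intro mult_right_mono)
    have "ennreal (u powr (p - 1)) \<le> x epowr (p - 1)"
      using False assms epowr_mono[of "p - 1" "ennreal u" x] by (auto simp: epowr_ennreal)
    then have "ennreal (u powr (p - 1)) * ennreal (u powr (1 - p)) \<le> x epowr (p - 1) * ennreal (u powr (1 - p))"
      by (rule mult_right_mono) simp
    then show "1 \<le> x epowr (p - 1) * ennreal (u powr (1 - p))"
      using assms by (simp flip: ennreal_mult powr_add)
  qed simp
  also have "\<dots> = x epowr p * ennreal (u powr (1 - p))"
    using epowr_add[of x "p - 1" 1] by (simp add: mult_ac)
  finally show ?thesis
    by (simp add: add_increasing2)
qed (simp add: add_increasing)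

text \<open>Young's inequality without its optimal constants: one of the two powers already dominates the
product.\<close>

lemma mult_le_powr_add_powr:
  fixes a b q :: real
  assumes "0 < a" "0 < b" "1 < q"
  shows "a * b \<le> a powr q + b powr (q / (q - 1))"
proof (cases "b \<le> a powr (q - 1)")
  case True
  then have "a * b \<le> a * a powr (q - 1)"
    using assms by simp
  also have "\<dots> = a powr q"
    using assms by (simp add: powr_mult_base)
  finally show ?thesis
    by (simp add: add_increasing2)
next
  case False
  then have "(a powr (q - 1)) powr (1 / (q - 1)) \<le> b powr (1 / (q - 1))"
    using assms by (intro powr_mono2) auto
  then have "a * b \<le> b * b powr (1 / (q - 1))"
    using assms by (simp add: powr_powr mult.commute)
  also have "\<dots> = b powr (q / (q - 1))"
    using assms powr_mult_base[of b "1 / (q - 1)"] by (simp add: field_simps)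
  finally show ?thesis
    by (simp add: add_increasing)
qed

text \<open>Such functions have two uses: the maximum with one of them makes a given function positive at a
small cost, and their multiples serve as finite cut-off levels.\<close>

lemma (in sigma_finite_measure) positive_function_small_norm:
  fixes w :: "'a \<Rightarrow> real"
  assumes [measurable]: "w \<in> borel_measurable M" and p: "1 < p" and d: "0 < d"
  obtains g :: "'a \<Rightarrow> real" where "g \<in> borel_measurable M" "\<And>x. 0 < g x"
    "(\<integral>\<^sup>+ x. ennreal (g x) epowr p * w x \<partial>M) \<le> ennreal d"
proof -
  interpret w: sigma_finite_measure "density M w"
    by (subst sigma_finite_iff_density_finite) auto
  obtain f :: "'a \<Rightarrow> real" where f: "f \<in> borel_measurable (density M w)" "\<And>x. 0 < f x" "\<And>x. f x \<le> 1" "integrable (density M w) f"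
    using w.obtain_positive_integrable_function by blast
  have [measurable]: "f \<in> borel_measurable M"
    using f(1) by simp
  obtain I where I: "(\<integral>\<^sup>+ x. f x * ennreal (w x) \<partial>M) = ennreal I" "0 \<le> I"
  proof -
    have "(\<integral>\<^sup>+ x. f x * ennreal (w x) \<partial>M) = (\<integral>\<^sup>+ x. f x \<partial>density M w)"
      by (simp add: nn_integral_density mult.commute)
    also have "\<dots> < top"
      using f(2,4) by (simp add: integrable_iff_bounded less_imp_le)
    finally show ?thesis
      using that by (cases "\<integral>\<^sup>+ x. f x * ennreal (w x) \<partial>M") auto
  qed
  define e where "e = min 1 (d / (I + 1))"
  have e: "0 < e" "e \<le> 1" "e * I \<le> d"
  proof -
    show "0 < e" "e \<le> 1" using d I by (auto simp: e_def)
    have "e * I \<le> d / (I + 1) * I"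
      using I by (intro mult_right_mono) (auto simp: e_def)
    also have "\<dots> \<le> d"
      using I d by (simp add: field_simps)
    finally show "e * I \<le> d" .
  qed
  show ?thesis
  proof
    show "(\<lambda>x. e * f x) \<in> borel_measurable M" by measurable
    show "0 < e * f x" for x using e f by simp
    have "(\<integral>\<^sup>+ x. ennreal (e * f x) epowr p * w x \<partial>M) \<le> (\<integral>\<^sup>+ x. ennreal e * (f x * ennreal (w x)) \<partial>M)"
    proof (rule nn_integral_mono)
      fix x
      have "(e * f x) powr p \<le> (e * f x) powr 1"
        using e f(2,3)[of x] p by (intro powr_mono') (auto simp: mult_le_one less_imp_le)
      then have "ennreal (e * f x) epowr p \<le> ennreal (e * f x)"
        using e f(2)[of x] by (simp add: epowr_ennreal ennreal_leI)
      then have "ennreal (e * f x) epowr p * w x \<le> ennreal (e * f x) * w x"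
        by (rule mult_right_mono) simp
      then show "ennreal (e * f x) epowr p * w x \<le> ennreal e * (f x * ennreal (w x))"
        using e f(2)[of x] by (simp add: ennreal_mult mult.assoc)
    qed
    also have "\<dots> = ennreal e * ennreal I"
      by (subst nn_integral_cmult) (simp_all add: I)
    also have "\<dots> \<le> ennreal d"
      using e I by (simp flip: ennreal_mult add: ennreal_leI)
    finally show "(\<integral>\<^sup>+ x. ennreal (e * f x) epowr p * w x \<partial>M) \<le> ennreal d" .
  qed
qed

context grids
begin

lemma mx_suminf_le:
  assumes [measurable]: "\<And>k. g k \<in> borel_measurable M" and Q: "E \<in> G" "Q \<in> E" "x \<in> Q"
  shows "(\<integral>\<^sup>+ y\<in>Q. (\<Sum>k. ennreal (a k) * g k y) \<partial>M) / emeasure M Q \<le> (\<Sum>k. ennreal (a k) * mx (g k) x)"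
proof -
  have [measurable]: "Q \<in> sets M"
    using Q sets_grid by auto
  have "(\<integral>\<^sup>+ y\<in>Q. (\<Sum>k. ennreal (a k) * g k y) \<partial>M) = (\<integral>\<^sup>+ y. (\<Sum>k. ennreal (a k) * (g k y * indicator Q y)) \<partial>M)"
    by (simp flip: mult.assoc)
  also have "\<dots> = (\<Sum>k. ennreal (a k) * (\<integral>\<^sup>+ y\<in>Q. g k y \<partial>M))"
    by (subst nn_integral_suminf) (simp_all add: nn_integral_cmult)
  finally have "(\<integral>\<^sup>+ y\<in>Q. (\<Sum>k. ennreal (a k) * g k y) \<partial>M) / emeasure M Q
      = (\<Sum>k. ennreal (a k) * ((\<integral>\<^sup>+ y\<in>Q. g k y \<partial>M) / emeasure M Q))"
    by (simp add: ennreal_times_divide flip: ennreal_suminf_divide)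
  also have "\<dots> \<le> (\<Sum>k. ennreal (a k) * mx (g k) x)"
    using Q by (intro suminf_le mult_left_mono average_le_maximal_fn) auto
  finally show ?thesis .
qed

text \<open>The Rubio de Francia algorithm: \<open>R g = (\<Sum>k. B\<^bsup>-k\<^esup> M\<^bsup>k\<^esup> g)\<close>. Its first term is \<open>g\<close>; applying \<open>M\<close> shifts
the series by one place, so that \<open>M (R g) \<le> B R g\<close>; and the series converges in norm as soon as \<open>B\<close>
exceeds the norm of \<open>M\<close>. The weight \<open>u\<close> is \<open>R g\<close>, altered on the null set where it is infinite.\<close>

lemma rubio_de_francia:
  fixes w :: "'a \<Rightarrow> real"
  assumes p: "1 < p" and K: "0 < K" and w: "w \<in> borel_measurable M" "\<And>x. 0 < w x"
    and bound: "\<And>f. f \<in> borel_measurable M \<Longrightarrow>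
      (\<integral>\<^sup>+ x. mx f x epowr p * w x \<partial>M) \<le> ennreal K * (\<integral>\<^sup>+ x. f x epowr p * w x \<partial>M)"
    and g: "g \<in> borel_measurable M" "\<And>x. g x \<noteq> 0" "(\<integral>\<^sup>+ x. g x epowr p * w x \<partial>M) \<noteq> top"
  obtains u where "A1 (2 * (2 * K) powr (1 / p)) u" "AE x in M. g x \<le> ennreal (u x)"
    "(\<integral>\<^sup>+ x. ennreal (u x) epowr p * w x \<partial>M) \<le> ennreal (2 powr p * 2) * (\<integral>\<^sup>+ x. g x epowr p * w x \<partial>M)"
proof -
  note [measurable] = w(1) g(1)
  \<comment> \<open>one factor \<open>2\<close> pays for \<open>suminf_half_epowr_le\<close>, the other makes the terms decay like \<open>2\<^bsup>-k\<^esup>\<close>\<close>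
  define B where "B = 2 * (2 * K) powr (1 / p)"
  have B: "0 < B" using K by (simp add: B_def)
  define h where "h k = (mx ^^ k) g" for k
  have h0: "h 0 = g" and h_Suc: "h (Suc k) = mx (h k)" for k
    by (simp_all add: h_def)
  have [measurable]: "h k \<in> borel_measurable M" for k
    by (cases k) (simp_all add: h0 h_Suc)
  have h_norm: "(\<integral>\<^sup>+ x. h k x epowr p * w x \<partial>M) \<le> ennreal (K ^ k) * (\<integral>\<^sup>+ x. g x epowr p * w x \<partial>M)" for k
  proof (induction k)
    case (Suc k)
    have "(\<integral>\<^sup>+ x. h (Suc k) x epowr p * w x \<partial>M) \<le> ennreal K * (\<integral>\<^sup>+ x. h k x epowr p * w x \<partial>M)"
      unfolding h_Suc by (rule bound) measurable
    also have "\<dots> \<le> ennreal K * (ennreal (K ^ k) * (\<integral>\<^sup>+ x. g x epowr p * w x \<partial>M))"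
      by (intro mult_left_mono Suc) simp
    finally show ?case
      using K by (simp add: ennreal_mult mult.assoc)
  qed (simp add: h0)
  define R where "R x = (\<Sum>k. ennreal ((1 / B) ^ k) * h k x)" for x
  have [measurable]: "R \<in> borel_measurable M"
    unfolding R_def by measurable
  have R_ge: "g x \<le> R x" for x
    using sum_le_suminf[of "\<lambda>k. ennreal ((1 / B) ^ k) * h k x" "{0}"] by (simp add: R_def h0)
  have R_norm: "(\<integral>\<^sup>+ x. R x epowr p * w x \<partial>M) \<le> ennreal (2 powr p * 2) * (\<integral>\<^sup>+ x. g x epowr p * w x \<partial>M)"
  proof -
    have Rp: "R x epowr p \<le> ennreal (2 powr p) * (\<Sum>k. ennreal (((2 / B) powr p) ^ k) * h k x epowr p)" for x
    proof -
      have "R x = (\<Sum>k. ennreal ((1 / 2) ^ k) * (ennreal ((2 / B) ^ k) * h k x))"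
        unfolding R_def using B
        by (intro suminf_cong) (simp add: mult.assoc[symmetric] power_divide flip: ennreal_mult)
      also have "\<dots> epowr p \<le> ennreal (2 powr p) * (\<Sum>k. (ennreal ((2 / B) ^ k) * h k x) epowr p)"
        using p by (intro suminf_half_epowr_le) simp
      also have "(\<lambda>k. (ennreal ((2 / B) ^ k) * h k x) epowr p) = (\<lambda>k. ennreal (((2 / B) powr p) ^ k) * h k x epowr p)"
        using p B by (auto simp: epowr_mult epowr_ennreal powr_power powr_realpow[symmetric] powr_powr mult.commute)
      finally show ?thesis .
    qed
    have "(\<integral>\<^sup>+ x. R x epowr p * w x \<partial>M)
        \<le> (\<integral>\<^sup>+ x. ennreal (2 powr p) * (\<Sum>k. ennreal (((2 / B) powr p) ^ k) * (h k x epowr p * w x)) \<partial>M)"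
    proof (rule nn_integral_mono)
      fix x
      have "R x epowr p * w x \<le> (ennreal (2 powr p) * (\<Sum>k. ennreal (((2 / B) powr p) ^ k) * h k x epowr p)) * w x"
        by (intro mult_right_mono Rp) simp
      then show "R x epowr p * w x \<le> ennreal (2 powr p) * (\<Sum>k. ennreal (((2 / B) powr p) ^ k) * (h k x epowr p * w x))"
        by (simp add: mult.assoc flip: ennreal_suminf_multc)
    qed
    also have "\<dots> = ennreal (2 powr p) * (\<Sum>k. ennreal (((2 / B) powr p) ^ k) * (\<integral>\<^sup>+ x. h k x epowr p * w x \<partial>M))"
      by (simp add: nn_integral_cmult nn_integral_suminf)
    also have "\<dots> \<le> ennreal (2 powr p) * (\<Sum>k. ennreal (((2 / B) powr p) ^ k) * (ennreal (K ^ k) * (\<integral>\<^sup>+ x. g x epowr p * w x \<partial>M)))"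
      using h_norm by (intro mult_left_mono suminf_le) auto
    also have "\<dots> = ennreal (2 powr p) * (\<Sum>k. ennreal ((1 / 2) ^ k) * (\<integral>\<^sup>+ x. g x epowr p * w x \<partial>M))"
    proof -
      have *: "(2 / B) powr p * K = 1 / 2"
        using K p by (simp add: B_def powr_divide powr_powr)
      have "((2 / B) powr p) ^ k * K ^ k = (1 / 2) ^ k" for k
        unfolding power_mult_distrib[symmetric] * ..
      then show ?thesis
        using K by (simp flip: mult.assoc ennreal_mult)
    qed
    also have "\<dots> = ennreal (2 powr p * 2) * (\<integral>\<^sup>+ x. g x epowr p * w x \<partial>M)"
      by (simp add: suminf_ennreal_half_powers ennreal_mult mult.assoc)
    finally show ?thesis .
  qed
  have R_fin: "AE x in M. R x \<noteq> top"
  proof -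
    have "(\<integral>\<^sup>+ x. R x epowr p * w x \<partial>M) \<noteq> top"
      using R_norm g(3) by (auto simp: top_unique ennreal_mult_eq_top_iff)
    then have "AE x in M. R x epowr p * w x \<noteq> \<infinity>"
      by (intro nn_integral_PInf_AE) auto
    then show ?thesis
    proof eventually_elim
      case (elim x)
      then show ?case
        using w(2)[of x] by (auto simp: ennreal_top_mult split: if_splits)
    qed
  qed
  have R_max: "(\<integral>\<^sup>+ y\<in>Q. R y \<partial>M) / emeasure M Q \<le> ennreal B * R x" if "E \<in> G" "Q \<in> E" "x \<in> Q" for E Q x
  proof -
    have "(\<integral>\<^sup>+ y\<in>Q. R y \<partial>M) / emeasure M Q \<le> (\<Sum>k. ennreal ((1 / B) ^ k) * h (Suc k) x)"
      unfolding R_def h_Suc by (rule mx_suminf_le[OF _ that]) measurable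
    also have "\<dots> = (\<Sum>k. ennreal B * (ennreal ((1 / B) ^ Suc k) * h (Suc k) x))"
      using B by (intro suminf_cong) (simp add: mult.assoc[symmetric] flip: ennreal_mult)
    also have "\<dots> = ennreal B * (\<Sum>k. ennreal ((1 / B) ^ Suc k) * h (Suc k) x)"
      by (rule ennreal_suminf_cmult)
    also have "\<dots> \<le> ennreal B * R x"
      unfolding R_def by (intro mult_left_mono) (subst (2) suminf_offset[of _ 1], auto)
    finally show ?thesis .
  qed
  define u where "u x = (if R x = top then 1 else enn2real (R x))" for x
  have [measurable]: "u \<in> borel_measurable M"
    unfolding u_def by measurable
  have u: "AE x in M. ennreal (u x) = R x"
    using R_fin by eventually_elim (simp add: u_def top.not_eq_extremum)
  have u_pos: "0 < u x" for x
  proof -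
    have "R x \<noteq> 0"
      using R_ge[of x] g(2)[of x] by auto
    then show ?thesis
      by (simp add: u_def enn2real_positive_iff top.not_eq_extremum zero_less_iff_neq_zero)
  qed
  show ?thesis
  proof
    show "A1 (2 * (2 * K) powr (1 / p)) u"
      unfolding A1_weight_def B_def[symmetric]
    proof (intro conjI allI ballI)
      fix Q assume "Q \<in> \<Union>G"
      then obtain E where E: "E \<in> G" "Q \<in> E" by auto
      have eq: "(\<integral>\<^sup>+ y\<in>Q. u y \<partial>M) = (\<integral>\<^sup>+ y\<in>Q. R y \<partial>M)"
        using u by (intro nn_integral_cong_AE) (auto elim!: eventually_mono)
      show "AE x in M. x \<in> Q \<longrightarrow> (\<integral>\<^sup>+ y\<in>Q. u y \<partial>M) / emeasure M Q \<le> ennreal (B * u x)"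
        using u
      proof eventually_elim
        case (elim x)
        then show ?case
          using R_max[OF E, of x] B by (simp add: eq ennreal_mult less_imp_le[OF u_pos])
      qed
    qed (use u_pos in auto)
    show "AE x in M. g x \<le> ennreal (u x)"
      using u by eventually_elim (simp add: R_ge)
    have "(\<integral>\<^sup>+ x. ennreal (u x) epowr p * w x \<partial>M) = (\<integral>\<^sup>+ x. R x epowr p * w x \<partial>M)"
      using u by (intro nn_integral_cong_AE) (auto elim!: eventually_mono)
    then show "(\<integral>\<^sup>+ x. ennreal (u x) epowr p * w x \<partial>M) \<le> ennreal (2 powr p * 2) * (\<integral>\<^sup>+ x. g x epowr p * w x \<partial>M)"
      using R_norm by simp
  qed
qed

end

section \<open>Extrapolation\<close>

context grids
begin

text \<open>Extrapolation in dual form. The Rubio de Francia algorithm gives \<open>A\<^sub>1\<close> weights \<open>u \<ge> H\<close> and \<open>v \<ge> h\<close>,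
for the weight \<open>w\<close> and for its dual. With these
\<open>F h \<le> F v \<le> F\<^sup>p v u\<^bsup>1-p\<^esup> + u v\<close>, the hypothesis applies to the weight \<open>v u\<^bsup>1-p\<^esup>\<close>, and
\<open>H\<^sup>p v u\<^bsup>1-p\<^esup> \<le> u v\<close> because \<open>H \<le> u\<close>. All that remains is the integral of \<open>u v\<close>, which Young's
inequality bounds by the two norms. The sum of the \<open>q\<close>-th and \<open>q'\<close>-th powers of the norms on the
right replaces their product, so that nothing has to be normalized.\<close>

lemma extrapolation_pairing:
  assumes p: "1 < p" and q: "1 < q" and c: "0 < c"
  obtains c' L where "0 < c'" "0 < L"
    "\<And>K F H h w. 0 \<le> K \<Longrightarrow> F \<in> borel_measurable M \<Longrightarrow> H \<in> borel_measurable M \<Longrightarrow> h \<in> borel_measurable M \<Longrightarrow>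
      (\<And>v. factored c' p v \<Longrightarrow> (\<integral>\<^sup>+ x. F x epowr p * v x \<partial>M) \<le> ennreal K * (\<integral>\<^sup>+ x. H x epowr p * v x \<partial>M)) \<Longrightarrow>
      factored c q w \<Longrightarrow>
      (\<integral>\<^sup>+ x. F x * h x \<partial>M) \<le> ennreal ((K + 1) * L) *
        ((\<integral>\<^sup>+ x. H x epowr q * w x \<partial>M) + (\<integral>\<^sup>+ x. h x epowr (q / (q - 1)) * w x powr (1 / (1 - q)) \<partial>M))"
proof -
  define q' where "q' = q / (q - 1)"
  have q': "1 < q'" using q by (simp add: q'_def field_simps)
  obtain K1 where K1: "0 < K1" "\<And>w f. factored c q w \<Longrightarrow> f \<in> borel_measurable M \<Longrightarrow>
    (\<integral>\<^sup>+ x. mx f x epowr q * w x \<partial>M) \<le> ennreal K1 * (\<integral>\<^sup>+ x. f x epowr q * w x \<partial>M)"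
    using muckenhoupt_factored[OF q c] by blast
  obtain K2 where K2: "0 < K2" "\<And>w f. factored c q' w \<Longrightarrow> f \<in> borel_measurable M \<Longrightarrow>
    (\<integral>\<^sup>+ x. mx f x epowr q' * w x \<partial>M) \<le> ennreal K2 * (\<integral>\<^sup>+ x. f x epowr q' * w x \<partial>M)"
    using muckenhoupt_factored[OF q' c] by blast
  define c' where "c' = max (2 * (2 * K1) powr (1 / q)) (2 * (2 * K2) powr (1 / q'))"
  define L where "L = 2 powr q * 2 + 2 powr q' * 2"
  show ?thesis
  proof
    show "0 < c'" using K1 by (auto simp: c'_def less_max_iff_disj)
    show "0 < L" by (simp add: L_def add_pos_pos)
  next
    fix K :: real and F H h :: "'a \<Rightarrow> ennreal" and w :: "'a \<Rightarrow> real"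
    assume K: "0 \<le> K" and [measurable]: "F \<in> borel_measurable M" "H \<in> borel_measurable M" "h \<in> borel_measurable M"
      and FH: "\<And>v. factored c' p v \<Longrightarrow> (\<integral>\<^sup>+ x. F x epowr p * v x \<partial>M) \<le> ennreal K * (\<integral>\<^sup>+ x. H x epowr p * v x \<partial>M)"
      and w: "factored c q w"
    define s where "s x = w x powr (1 / (1 - q))" for x
    have s: "factored c q' s"
      unfolding s_def q'_def using w q by (rule factored_weight_dual)
    have meas [measurable]: "w \<in> borel_measurable M" "s \<in> borel_measurable M" and pos: "\<And>x. 0 < w x" "\<And>x. 0 < s x"
      using factored_weight_measurable[OF w] factored_weight_measurable[OF s]
        factored_weight_pos[OF w] factored_weight_pos[OF s] by auto
    let ?A = "(\<integral>\<^sup>+ x. H x epowr q * w x \<partial>M) + (\<integral>\<^sup>+ x. h x epowr q' * s x \<partial>M)"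
    have L: "0 < (K + 1) * L" using K by (simp add: L_def add_nonneg_pos add_pos_pos)
    have approx: "(\<integral>\<^sup>+ x. F x * h x \<partial>M) \<le> ennreal ((K + 1) * L) * (?A + ennreal (2 * d))"
      if d: "0 < d" and fin: "?A < top" for d
    proof -
      \<comment> \<open>\<open>A\<^sub>1\<close> weights are positive, hence \<open>H\<close> and \<open>h\<close> have to be made so at a cost of \<open>d\<close>\<close>
      obtain g1 where [measurable]: "g1 \<in> borel_measurable M" and g1: "\<And>x. 0 < g1 x"
        "(\<integral>\<^sup>+ x. ennreal (g1 x) epowr q * w x \<partial>M) \<le> ennreal d"
        using positive_function_small_norm[OF _ q d, of w] by auto
      obtain g2 where [measurable]: "g2 \<in> borel_measurable M" and g2: "\<And>x. 0 < g2 x"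
        "(\<integral>\<^sup>+ x. ennreal (g2 x) epowr q' * s x \<partial>M) \<le> ennreal d"
        using positive_function_small_norm[OF _ q' d, of s] by auto
      have max_le: "(\<integral>\<^sup>+ x. max (a x) (ennreal (b x)) epowr r * v x \<partial>M)
          \<le> (\<integral>\<^sup>+ x. a x epowr r * v x \<partial>M) + ennreal d"
        if [measurable]: "a \<in> borel_measurable M" "b \<in> borel_measurable M" "v \<in> borel_measurable M"
          and b: "(\<integral>\<^sup>+ x. ennreal (b x) epowr r * v x \<partial>M) \<le> ennreal d" for a b r and v :: "'a \<Rightarrow> real"
      proof -
        have "(\<integral>\<^sup>+ x. max (a x) (ennreal (b x)) epowr r * v x \<partial>M)
          \<le> (\<integral>\<^sup>+ x. a x epowr r * v x + ennreal (b x) epowr r * v x \<partial>M)"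
          by (intro nn_integral_mono) (auto simp: max_def add_increasing add_increasing2)
        also have "\<dots> = (\<integral>\<^sup>+ x. a x epowr r * v x \<partial>M) + (\<integral>\<^sup>+ x. ennreal (b x) epowr r * v x \<partial>M)"
          by (rule nn_integral_add) auto
        finally show ?thesis
          using b by (meson add_left_mono order_trans)
      qed
      define H' where "H' x = max (H x) (ennreal (g1 x))" for x
      define h' where "h' x = max (h x) (ennreal (g2 x))" for x
      have [measurable]: "H' \<in> borel_measurable M" "h' \<in> borel_measurable M"
        unfolding H'_def h'_def by measurable
      have H': "(\<integral>\<^sup>+ x. H' x epowr q * w x \<partial>M) \<le> (\<integral>\<^sup>+ x. H x epowr q * w x \<partial>M) + ennreal d"
        unfolding H'_def using g1 by (intro max_le) auto
      have h': "(\<integral>\<^sup>+ x. h' x epowr q' * s x \<partial>M) \<le> (\<integral>\<^sup>+ x. h x epowr q' * s x \<partial>M) + ennreal d"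
        unfolding h'_def using g2 by (intro max_le) auto
      obtain u where u: "A1 (2 * (2 * K1) powr (1 / q)) u" "AE x in M. H' x \<le> ennreal (u x)"
        "(\<integral>\<^sup>+ x. ennreal (u x) epowr q * w x \<partial>M) \<le> ennreal (2 powr q * 2) * (\<integral>\<^sup>+ x. H' x epowr q * w x \<partial>M)"
      proof (rule rubio_de_francia[of q K1 w H'])
        show "(\<integral>\<^sup>+ x. mx f x epowr q * w x \<partial>M) \<le> ennreal K1 * (\<integral>\<^sup>+ x. f x epowr q * w x \<partial>M)"
          if "f \<in> borel_measurable M" for f
          using K1(2)[OF w that] .
        show "H' x \<noteq> 0" for x
          using g1(1)[of x] by (auto simp: H'_def max_def split: if_splits)
        show "(\<integral>\<^sup>+ x. H' x epowr q * w x \<partial>M) \<noteq> top"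
          using H' fin by (auto simp: top_unique)
        show "1 < q" by fact
        show "0 < K1" by fact
        show "w \<in> borel_measurable M" by measurable
        show "0 < w x" for x by (rule pos)
        show "H' \<in> borel_measurable M"
          by measurable
      qed (rule that)
      obtain v where v: "A1 (2 * (2 * K2) powr (1 / q')) v" "AE x in M. h' x \<le> ennreal (v x)"
        "(\<integral>\<^sup>+ x. ennreal (v x) epowr q' * s x \<partial>M) \<le> ennreal (2 powr q' * 2) * (\<integral>\<^sup>+ x. h' x epowr q' * s x \<partial>M)"
      proof (rule rubio_de_francia[of q' K2 s h'])
        show "(\<integral>\<^sup>+ x. mx f x epowr q' * s x \<partial>M) \<le> ennreal K2 * (\<integral>\<^sup>+ x. f x epowr q' * s x \<partial>M)"
          if "f \<in> borel_measurable M" for f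
          using K2(2)[OF s that] .
        show "h' x \<noteq> 0" for x
          using g2(1)[of x] by (auto simp: h'_def max_def split: if_splits)
        show "(\<integral>\<^sup>+ x. h' x epowr q' * s x \<partial>M) \<noteq> top"
          using h' fin by (auto simp: top_unique)
        show "1 < q'" by fact
        show "0 < K2" by fact
        show "s \<in> borel_measurable M" by measurable
        show "0 < s x" for x by (rule pos)
        show "h' \<in> borel_measurable M"
          by measurable
      qed (rule that)
      have [measurable]: "u \<in> borel_measurable M" "v \<in> borel_measurable M" and uv: "\<And>x. 0 < u x" "\<And>x. 0 < v x"
        using u v by (auto simp: A1_weight_def)
      have W: "factored c' p (\<lambda>x. v x * u x powr (1 - p))"
        unfolding factored_weight_def
        using A1_weight_mono[OF u(1), of c'] A1_weight_mono[OF v(1), of c'] by (auto simp: c'_def)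
      have "(\<integral>\<^sup>+ x. F x * h x \<partial>M) \<le> (\<integral>\<^sup>+ x. F x epowr p * ennreal (v x * u x powr (1 - p)) + ennreal (u x * v x) \<partial>M)"
      proof (rule nn_integral_mono_AE)
        show "AE x in M. F x * h x \<le> F x epowr p * ennreal (v x * u x powr (1 - p)) + ennreal (u x * v x)"
          using v(2)
        proof eventually_elim
          case (elim x)
          have "F x * h x \<le> (F x epowr p * ennreal (u x powr (1 - p)) + ennreal (u x)) * ennreal (v x)"
            using elim uv[of x] p by (intro mult_mono le_epowr_split) (auto simp: h'_def)
          also have "\<dots> = F x epowr p * ennreal (v x * u x powr (1 - p)) + ennreal (u x * v x)"
            using uv[of x] by (simp add: ring_distribs ennreal_mult mult_ac)
          finally show ?case .
        qed
      qed
      also have "\<dots> = (\<integral>\<^sup>+ x. F x epowr p * ennreal (v x * u x powr (1 - p)) \<partial>M) + (\<integral>\<^sup>+ x. ennreal (u x * v x) \<partial>M)"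
        by (rule nn_integral_add) auto
      also have "\<dots> \<le> ennreal K * (\<integral>\<^sup>+ x. H x epowr p * ennreal (v x * u x powr (1 - p)) \<partial>M) + (\<integral>\<^sup>+ x. ennreal (u x * v x) \<partial>M)"
        by (intro add_right_mono FH W)
      also have "\<dots> \<le> ennreal K * (\<integral>\<^sup>+ x. ennreal (u x * v x) \<partial>M) + (\<integral>\<^sup>+ x. ennreal (u x * v x) \<partial>M)"
      proof (intro add_right_mono mult_left_mono nn_integral_mono_AE)
        show "AE x in M. H x epowr p * ennreal (v x * u x powr (1 - p)) \<le> ennreal (u x * v x)"
          using u(2)
        proof eventually_elim
          case (elim x)
          then have "H x epowr p \<le> ennreal (u x) epowr p"
            using p by (intro epowr_mono) (auto simp: H'_def)
          then have "H x epowr p * ennreal (v x * u x powr (1 - p)) \<le> ennreal (u x powr p) * ennreal (v x * u x powr (1 - p))"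
            using uv[of x] by (intro mult_right_mono) (auto simp: epowr_ennreal)
          also have "\<dots> = ennreal (v x * (u x powr p * u x powr (1 - p)))"
            using uv[of x] by (simp add: mult_ac flip: ennreal_mult)
          also have "\<dots> = ennreal (u x * v x)"
            using uv[of x] by (simp add: mult.commute flip: powr_add)
          finally show ?case .
        qed
      qed simp
      also have "\<dots> = ennreal (K + 1) * (\<integral>\<^sup>+ x. ennreal (u x * v x) \<partial>M)"
        using K by (simp add: ring_distribs)
      also have "\<dots> \<le> ennreal (K + 1) * (ennreal L * (?A + ennreal (2 * d)))"
      proof (rule mult_left_mono)
        have "(\<integral>\<^sup>+ x. ennreal (u x * v x) \<partial>M) \<le> (\<integral>\<^sup>+ x. ennreal (u x) epowr q * w x + ennreal (v x) epowr q' * s x \<partial>M)"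
        proof (rule nn_integral_mono)
          fix x
          have eq: "u x * v x = (u x * w x powr (1 / q)) * (v x * w x powr - (1 / q))"
            using pos(1)[of x] by (simp add: powr_minus)
          have "u x * v x \<le> (u x * w x powr (1 / q)) powr q + (v x * w x powr - (1 / q)) powr q'"
            unfolding eq q'_def using uv[of x] pos(1)[of x] q by (intro mult_le_powr_add_powr) auto
          also have "(u x * w x powr (1 / q)) powr q = u x powr q * w x"
            using uv[of x] pos(1)[of x] q by (simp add: powr_mult powr_powr)
          also have "(v x * w x powr - (1 / q)) powr q' = v x powr q' * s x"
          proof -
            have "- (1 / q) * q' = 1 / (1 - q)"
              using q by (simp add: q'_def field_simps)
            then show ?thesis
              using uv[of x] pos(1)[of x] by (simp only: s_def powr_mult powr_powr less_imp_le powr_ge_zero)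
          qed
          finally show "ennreal (u x * v x) \<le> ennreal (u x) epowr q * w x + ennreal (v x) epowr q' * s x"
            using uv[of x] pos[of x] by (simp add: epowr_ennreal less_imp_le ennreal_leI flip: ennreal_mult ennreal_plus)
        qed
        also have "\<dots> = (\<integral>\<^sup>+ x. ennreal (u x) epowr q * w x \<partial>M) + (\<integral>\<^sup>+ x. ennreal (v x) epowr q' * s x \<partial>M)"
          by (rule nn_integral_add) auto
        also have "\<dots> \<le> ennreal (2 powr q * 2) * ((\<integral>\<^sup>+ x. H x epowr q * w x \<partial>M) + ennreal d)
            + ennreal (2 powr q' * 2) * ((\<integral>\<^sup>+ x. h x epowr q' * s x \<partial>M) + ennreal d)"
          by (rule add_mono[OF order_trans[OF u(3) mult_left_mono[OF H']] order_trans[OF v(3) mult_left_mono[OF h']]]) simp_all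
        also have "\<dots> \<le> ennreal L * ((\<integral>\<^sup>+ x. H x epowr q * w x \<partial>M) + ennreal d)
            + ennreal L * ((\<integral>\<^sup>+ x. h x epowr q' * s x \<partial>M) + ennreal d)"
        proof (rule add_mono; rule mult_right_mono)
          show "ennreal (2 powr q * 2) \<le> ennreal L" "ennreal (2 powr q' * 2) \<le> ennreal L"
            by (simp_all add: L_def ennreal_leI)
        qed simp_all
        also have "\<dots> = ennreal L * (?A + ennreal (2 * d))"
        proof -
          have dd: "ennreal (2 * d) = ennreal d + ennreal d"
            unfolding mult_2 by (intro ennreal_plus less_imp_le d)
          have eq: "x * (a + y) + x * (b + y) = x * (a + b + (y + y))" for a b x y :: ennreal
            by (simp add: distrib_left add_ac)
          show ?thesis
            unfolding dd by (rule eq)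
        qed
        finally show "(\<integral>\<^sup>+ x. ennreal (u x * v x) \<partial>M) \<le> ennreal L * (?A + ennreal (2 * d))" .
      qed simp
      also have "\<dots> = ennreal ((K + 1) * L) * (?A + ennreal (2 * d))"
        using K by (simp add: L_def ennreal_mult mult.assoc)
      finally show ?thesis .
    qed
    have "(\<integral>\<^sup>+ x. F x * h x \<partial>M) \<le> ennreal ((K + 1) * L) * ?A"
    proof (rule ennreal_le_epsilon)
      fix e :: real assume e: "0 < e" and "ennreal ((K + 1) * L) * ?A < top"
      then have "?A < top"
        using L by (auto simp: ennreal_mult_less_top ennreal_eq_0_iff)
      then have "(\<integral>\<^sup>+ x. F x * h x \<partial>M) \<le> ennreal ((K + 1) * L) * (?A + ennreal (2 * (e / (2 * ((K + 1) * L)))))"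
        using e L by (intro approx) auto
      also have "\<dots> = ennreal ((K + 1) * L) * ?A + ennreal (((K + 1) * L) * (2 * (e / (2 * ((K + 1) * L)))))"
        using e L by (simp only: distrib_left ennreal_mult less_imp_le divide_nonneg_pos mult_nonneg_nonneg zero_le_numeral mult_pos_pos zero_less_numeral)
      also have "((K + 1) * L) * (2 * (e / (2 * ((K + 1) * L)))) = e"
        using L by (simp add: field_simps)
      finally show "(\<integral>\<^sup>+ x. F x * h x \<partial>M) \<le> ennreal ((K + 1) * L) * ?A + ennreal e" .
    qed
    then show "(\<integral>\<^sup>+ x. F x * h x \<partial>M) \<le> ennreal ((K + 1) * L) *
        ((\<integral>\<^sup>+ x. H x epowr q * w x \<partial>M) + (\<integral>\<^sup>+ x. h x epowr (q / (q - 1)) * w x powr (1 / (1 - q)) \<partial>M))"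
      unfolding s_def q'_def .
  qed
qed

lemma le_SUP_truncation:
  fixes y :: ennreal and g :: real
  assumes "0 < g"
  shows "y \<le> (SUP n. min y (ennreal (real n * g)))"
proof (cases y)
  case (real r)
  obtain n where "r / g \<le> real n"
    using real_arch_simple by blast
  then have "y \<le> ennreal (real n * g)"
    using assms real by (auto simp: field_simps intro!: ennreal_leI)
  then show ?thesis
    by (intro SUP_upper2[of n]) auto
next
  case top
  have "(SUP n. ennreal (real n * g)) = top"
  proof (rule ennreal_SUP_eq_top)
    fix k
    obtain n where "real k / g \<le> real n"
      using real_arch_simple by blast
    then have "of_nat k \<le> ennreal (real n * g)"
      using assms by (auto simp: field_simps ennreal_of_nat_eq_real_of_nat intro!: ennreal_leI)
    then show "\<exists>n\<in>UNIV. of_nat k \<le> ennreal (real n * g)" by auto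
  qed
  then show ?thesis
    by (simp add: top min_def top_unique)
qed

text \<open>Testing the dual form with \<open>h = e F\<^bsup>q-1\<^esup> w\<close> turns both \<open>F h\<close> and \<open>h\<^bsup>q'\<^esup> w\<^bsup>1-q'\<^esup>\<close> into multiples of
\<open>F\<^sup>q w\<close>, with factors \<open>e\<close> and \<open>e\<^bsup>q'\<^esup>\<close>. As \<open>q' > 1\<close>, for small \<open>e\<close> the term on the right can be
absorbed into the left hand side. Absorption needs a finite integral, so \<open>F\<close> is first cut off.\<close>

theorem extrapolation:
  assumes p: "1 < p" and q: "1 < q" and c: "0 < c"
  shows "\<exists>c'>(0::real). \<forall>K\<ge>(0::real). \<exists>C>(0::real). \<forall>F H. F \<in> borel_measurable M \<longrightarrow> H \<in> borel_measurable M \<longrightarrow>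
    (\<forall>w. factored c' p w \<longrightarrow> (\<integral>\<^sup>+ x. F x epowr p * w x \<partial>M) \<le> ennreal K * (\<integral>\<^sup>+ x. H x epowr p * w x \<partial>M)) \<longrightarrow>
    (\<forall>w. factored c q w \<longrightarrow> (\<integral>\<^sup>+ x. F x epowr q * w x \<partial>M) \<le> ennreal C * (\<integral>\<^sup>+ x. H x epowr q * w x \<partial>M))"
proof -
  define q' where "q' = q / (q - 1)"
  have q': "1 < q'" "(q - 1) * q' = q" using q by (auto simp: q'_def field_simps)
  obtain c' L where c': "0 < c'" and L: "0 < L" and pairing:
    "\<And>K F H h w. 0 \<le> K \<Longrightarrow> F \<in> borel_measurable M \<Longrightarrow> H \<in> borel_measurable M \<Longrightarrow> h \<in> borel_measurable M \<Longrightarrow>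
      (\<And>v. factored c' p v \<Longrightarrow> (\<integral>\<^sup>+ x. F x epowr p * v x \<partial>M) \<le> ennreal K * (\<integral>\<^sup>+ x. H x epowr p * v x \<partial>M)) \<Longrightarrow>
      factored c q w \<Longrightarrow>
      (\<integral>\<^sup>+ x. F x * h x \<partial>M) \<le> ennreal ((K + 1) * L) *
        ((\<integral>\<^sup>+ x. H x epowr q * w x \<partial>M) + (\<integral>\<^sup>+ x. h x epowr q' * w x powr (1 / (1 - q)) \<partial>M))"
    using extrapolation_pairing[OF p q c] unfolding q'_def by blast
  show ?thesis
  proof (rule exI[of _ c'], intro conjI c' allI impI)
    fix K :: real assume K: "0 \<le> K"
    define B where "B = (K + 1) * L"
    have B: "0 < B" using K L by (simp add: B_def)
    \<comment> \<open>chosen so that \<open>B e\<^bsup>q'\<^esup> = e / 2\<close>, which leaves half of the left hand side after absorption\<close>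
    define e where "e = (1 / (2 * B)) powr (1 / (q' - 1))"
    have e: "0 < e" using B by (simp add: e_def)
    have Be: "B * e powr q' = e / 2"
    proof -
      have "e powr (q' - 1) = 1 / (2 * B)"
        using B q' by (simp add: e_def powr_powr)
      then have "e powr q' = e * (1 / (2 * B))"
        using e powr_mult_base[of e "q' - 1"] by simp
      then show ?thesis
        using B by simp
    qed
    show "\<exists>C>(0::real). \<forall>F H. F \<in> borel_measurable M \<longrightarrow> H \<in> borel_measurable M \<longrightarrow>
      (\<forall>w. factored c' p w \<longrightarrow> (\<integral>\<^sup>+ x. F x epowr p * w x \<partial>M) \<le> ennreal K * (\<integral>\<^sup>+ x. H x epowr p * w x \<partial>M)) \<longrightarrow>
      (\<forall>w. factored c q w \<longrightarrow> (\<integral>\<^sup>+ x. F x epowr q * w x \<partial>M) \<le> ennreal C * (\<integral>\<^sup>+ x. H x epowr q * w x \<partial>M))"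
    proof (intro exI[of _ "2 * B / e"] conjI allI impI)
      show "0 < 2 * B / e" using B e by simp
    next
      fix F H :: "'a \<Rightarrow> ennreal" and w :: "'a \<Rightarrow> real"
      assume [measurable]: "F \<in> borel_measurable M" "H \<in> borel_measurable M"
        and FH: "\<forall>w. factored c' p w \<longrightarrow> (\<integral>\<^sup>+ x. F x epowr p * w x \<partial>M) \<le> ennreal K * (\<integral>\<^sup>+ x. H x epowr p * w x \<partial>M)"
        and w: "factored c q w"
      have [measurable]: "w \<in> borel_measurable M" and w0: "\<And>x. 0 < w x"
        using factored_weight_measurable[OF w] factored_weight_pos[OF w] by auto
      obtain g where [measurable]: "g \<in> borel_measurable M" and g: "\<And>x. 0 < g x"
        "(\<integral>\<^sup>+ x. ennreal (g x) epowr q * w x \<partial>M) \<le> ennreal 1"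
        using positive_function_small_norm[OF _ q, of w 1] by auto
      define T where "T n x = min (F x) (ennreal (real n * g x))" for n x
      have [measurable]: "T n \<in> borel_measurable M" for n
        unfolding T_def by measurable
      have T: "(\<integral>\<^sup>+ x. T n x epowr q * w x \<partial>M) \<le> ennreal (2 * B / e) * (\<integral>\<^sup>+ x. H x epowr q * w x \<partial>M)" for n
      proof -
        define I where "I = (\<integral>\<^sup>+ x. T n x epowr q * w x \<partial>M)"
        have "I \<le> (\<integral>\<^sup>+ x. ennreal (real n powr q) * (ennreal (g x) epowr q * w x) \<partial>M)"
          unfolding I_def
        proof (rule nn_integral_mono)
          fix x
          have "T n x epowr q \<le> ennreal (real n * g x) epowr q"
            using q by (intro epowr_mono) (auto simp: T_def)
          also have "\<dots> = ennreal (real n powr q) * ennreal (g x) epowr q"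
            using g(1)[of x] q by (simp add: epowr_ennreal epowr_mult ennreal_mult less_imp_le)
          finally show "T n x epowr q * w x \<le> ennreal (real n powr q) * (ennreal (g x) epowr q * w x)"
            by (simp add: mult_right_mono flip: mult.assoc)
        qed
        also have "\<dots> = ennreal (real n powr q) * (\<integral>\<^sup>+ x. ennreal (g x) epowr q * w x \<partial>M)"
          by (rule nn_integral_cmult) auto
        also have "\<dots> \<le> ennreal (real n powr q) * ennreal 1"
          by (intro mult_left_mono g) auto
        finally have "I \<noteq> top"
          by (auto simp: top_unique)
        then obtain a where a: "I = ennreal a" "0 \<le> a"
          by (cases I) auto
        define h where "h x = ennreal e * (T n x epowr (q - 1) * ennreal (w x))" for x
        have [measurable]: "h \<in> borel_measurable M"
          unfolding h_def by measurable
        have "ennreal e * I = (\<integral>\<^sup>+ x. ennreal e * (T n x epowr q * w x) \<partial>M)"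
          unfolding I_def by (rule nn_integral_cmult[symmetric]) auto
        also have "\<dots> \<le> (\<integral>\<^sup>+ x. F x * h x \<partial>M)"
        proof (rule nn_integral_mono)
          fix x
          have "T n x epowr q = T n x * T n x epowr (q - 1)"
            using epowr_add[of "T n x" 1 "q - 1"] by simp
          also have "\<dots> \<le> F x * T n x epowr (q - 1)"
            by (intro mult_right_mono) (auto simp: T_def)
          finally have "ennreal e * w x * T n x epowr q \<le> ennreal e * w x * (F x * T n x epowr (q - 1))"
            by (rule mult_left_mono) simp
          then show "ennreal e * (T n x epowr q * w x) \<le> F x * h x"
            by (simp add: h_def mult_ac)
        qed
        also have "\<dots> \<le> ennreal B * ((\<integral>\<^sup>+ x. H x epowr q * w x \<partial>M) + (\<integral>\<^sup>+ x. h x epowr q' * w x powr (1 / (1 - q)) \<partial>M))"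
          unfolding B_def by (rule pairing[OF K _ _ _ _ w]) (use FH in auto)
        also have "(\<integral>\<^sup>+ x. h x epowr q' * w x powr (1 / (1 - q)) \<partial>M) = (\<integral>\<^sup>+ x. ennreal (e powr q') * (T n x epowr q * w x) \<partial>M)"
        proof (rule nn_integral_cong)
          fix x
          have "w x powr q' * w x powr (1 / (1 - q)) = w x powr (q' + 1 / (1 - q))"
            by (simp add: powr_add)
          also have "q' + 1 / (1 - q) = 1"
          proof -
            have "1 / (1 - q) = - (1 / (q - 1))"
              using q by (simp add: divide_simps)
            then have "q' + 1 / (1 - q) = (q - 1) / (q - 1)"
              by (simp only: q'_def diff_divide_distrib add_uminus_conv_diff)
            also have "\<dots> = 1"
              using q by simp
            finally show ?thesis .
          qed
          finally have "w x powr q' * w x powr (1 / (1 - q)) = w x"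
            using w0[of x] by simp
          then have "ennreal (w x powr q') * ennreal (w x powr (1 / (1 - q))) = ennreal (w x)"
            by (simp flip: ennreal_mult)
          moreover have "h x epowr q' = ennreal (e powr q') * (T n x epowr q * ennreal (w x powr q'))"
            using e w0[of x] q' by (simp add: h_def epowr_mult epowr_ennreal)
          ultimately show "h x epowr q' * w x powr (1 / (1 - q)) = ennreal (e powr q') * (T n x epowr q * w x)"
            by (simp add: mult.assoc)
        qed
        also have "\<dots> = ennreal (e powr q') * I"
          unfolding I_def by (rule nn_integral_cmult) auto
        finally have main: "ennreal e * I \<le> ennreal B * ((\<integral>\<^sup>+ x. H x epowr q * w x \<partial>M) + ennreal (e powr q') * I)" .
        show ?thesis
        proof (cases "\<integral>\<^sup>+ x. H x epowr q * w x \<partial>M")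
          case (real b)
          have "e * a \<le> B * (b + e powr q' * a)"
            using main a real e B by (simp flip: ennreal_mult ennreal_plus)
          then have "e * a \<le> B * b + e / 2 * a"
            using Be by (simp add: distrib_left mult.assoc[symmetric])
          then have "a \<le> 2 * B / e * b"
            using e by (simp add: field_simps)
          then have "ennreal a \<le> ennreal (2 * B / e * b)"
            by (rule ennreal_leI)
          also have "\<dots> = ennreal (2 * B / e) * ennreal b"
            using B e real by (intro ennreal_mult) auto
          finally show ?thesis
            using a real by (simp add: I_def)
        next
          case top
          then show ?thesis
            using B e by (simp add: ennreal_mult_top)
        qed
      qed
      have "(\<integral>\<^sup>+ x. F x epowr q * w x \<partial>M) \<le> (\<integral>\<^sup>+ x. (SUP n. T n x epowr q * w x) \<partial>M)"
      proof (rule nn_integral_mono)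
        fix x
        have "F x \<le> (SUP n. T n x)"
          unfolding T_def using g(1)[of x] by (rule le_SUP_truncation)
        also have "\<dots> \<le> (SUP n. T n x epowr q) epowr (1 / q)"
        proof (rule SUP_least)
          fix n
          have "T n x epowr q \<le> (SUP n. T n x epowr q)"
            by (rule SUP_upper) simp
          then show "T n x \<le> (SUP n. T n x epowr q) epowr (1 / q)"
            using q by (simp add: epowr_le_iff)
        qed
        finally have "F x epowr q \<le> (SUP n. T n x epowr q)"
          using q by (simp add: epowr_le_iff)
        then have "F x epowr q * w x \<le> (SUP n. T n x epowr q) * w x"
          by (rule mult_right_mono) simp
        then show "F x epowr q * w x \<le> (SUP n. T n x epowr q * w x)"
          by (simp add: SUP_mult_right_ennreal)
      qed
      also have "\<dots> = (SUP n. \<integral>\<^sup>+ x. T n x epowr q * w x \<partial>M)"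
      proof (rule nn_integral_monotone_convergence_SUP)
        show "incseq (\<lambda>n x. T n x epowr q * ennreal (w x))"
          unfolding incseq_def le_fun_def T_def using q less_imp_le[OF g(1)]
          by (intro allI impI mult_right_mono epowr_mono min.mono ennreal_leI) auto
      qed auto
      also have "\<dots> \<le> ennreal (2 * B / e) * (\<integral>\<^sup>+ x. H x epowr q * w x \<partial>M)"
        by (intro SUP_least T)
      finally show "(\<integral>\<^sup>+ x. F x epowr q * w x \<partial>M) \<le> ennreal (2 * B / e) * (\<integral>\<^sup>+ x. H x epowr q * w x \<partial>M)" .
    qed
  qed
qed

end

section \<open>Shifted triadic grids\<close>

text \<open>In base 3 a grid shifted by half a side length is again nested, because \<open>3 / 2\<close> and \<open>1 / 2\<close> differ
by an integer. In base 2 the shifts would have to alternate with the scale.\<close>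

definition shift :: "bool ^ 'n \<Rightarrow> 'n \<Rightarrow> real" where
  "shift b i = (if b $ i then 1 / 2 else 0)"

definition cell :: "bool ^ 'n \<Rightarrow> int \<Rightarrow> int ^ 'n \<Rightarrow> (real ^ 'n) set" where
  "cell b k j = {x. \<forall>i. \<lfloor>3 powr k * x $ i + shift b i\<rfloor> = j $ i}"

definition grid :: "bool ^ 'n \<Rightarrow> (real ^ 'n) set set" where
  "grid b = {cell b k j | k j. True}"

text \<open>A cell of a finer scale lies in one cell of each coarser scale, as the coarse index can be
computed from the fine one.\<close>

lemma floor_refines:
  fixes x y :: real
  assumes eq: "\<lfloor>3 powr (real_of_int k + real l) * x + shift b i\<rfloor> = \<lfloor>3 powr (real_of_int k + real l) * y + shift b i\<rfloor>"
  shows "\<lfloor>3 powr k * x + shift b i\<rfloor> = \<lfloor>3 powr k * y + shift b i\<rfloor>"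
  using eq
proof (induction l)
  case (Suc l)
  \<comment> \<open>twice the shift, which is an integer\<close>
  define d :: int where "d = (if b $ i then 1 else 0)"
  have step: "\<lfloor>3 powr (real_of_int k + real l) * z + shift b i\<rfloor>
      = (\<lfloor>3 powr (real_of_int k + real (Suc l)) * z + shift b i\<rfloor> + d) div 3" for z
  proof -
    have "3 powr (real_of_int k + real (Suc l)) = 3 * 3 powr (real_of_int k + real l)"
      using powr_add[of 3 "real_of_int k + real l" 1] by (simp add: add_ac)
    then have "3 powr (real_of_int k + real l) * z + shift b i
        = (3 powr (real_of_int k + real (Suc l)) * z + shift b i + of_int d) / of_int 3"
      by (simp add: shift_def d_def)
    then show ?thesis
      by (simp only: floor_divide_real_eq_div) simp
  qed
  from Suc.prems have "\<lfloor>3 powr (real_of_int k + real l) * x + shift b i\<rfloor> = \<lfloor>3 powr (real_of_int k + real l) * y + shift b i\<rfloor>"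
    by (simp only: step)
  then show ?case
    by (rule Suc.IH)
qed simp

lemma laminar_triadic_grid: "laminar (grid b)"
proof -
  have nested: "cell b l j' \<subseteq> cell b k j" if "k \<le> l" "x \<in> cell b k j" "x \<in> cell b l j'" for k l j j' x
  proof
    fix y assume y: "y \<in> cell b l j'"
    have l: "real_of_int l = real_of_int k + real (nat (l - k))"
      using that by simp
    have "\<lfloor>3 powr k * y $ i + shift b i\<rfloor> = \<lfloor>3 powr k * x $ i + shift b i\<rfloor>" for i
      by (rule floor_refines[where l="nat (l - k)"]) (use y that in \<open>simp add: cell_def flip: l\<close>)
    then show "y \<in> cell b k j"
      using that by (simp add: cell_def)
  qed
  show ?thesis
    unfolding laminar_def
  proof (intro ballI)
    fix P Q assume "P \<in> grid b" "Q \<in> grid b"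
    then obtain k j l j' where PQ: "P = cell b k j" "Q = cell b l j'"
      by (auto simp: grid_def)
    show "P \<inter> Q = {} \<or> P \<subseteq> Q \<or> Q \<subseteq> P"
    proof (cases "P \<inter> Q = {}")
      case False
      then obtain x where "x \<in> cell b k j" "x \<in> cell b l j'"
        by (auto simp: PQ)
      then show ?thesis
        unfolding PQ using nested[of k l x j j'] nested[of l k x j' j] linear[of k l] by blast
    qed simp
  qed
qed

lemma countable_triadic_grid: "countable (grid b)"
proof -
  have "grid b = (\<lambda>(k, j). cell b k j) ` UNIV"
    by (auto simp: grid_def)
  then show ?thesis by simp
qed

lemma cell_borel [measurable]: "cell b k j \<in> sets borel"
  unfolding cell_def by measurable

lemma emeasure_cell:
  fixes b :: "bool ^ 'n"
  shows "emeasure lborel (cell b k j) = ennreal ((3 powr - k) ^ CARD('n))"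
proof -
  define lo hi :: "real ^ 'n" where
    "lo = (\<chi> i. (j $ i - shift b i) * 3 powr - k)" and "hi = (\<chi> i. (j $ i + 1 - shift b i) * 3 powr - k)"
  have side: "(hi - lo) \<bullet> e = 3 powr - k" if "e \<in> Basis" for e
    using that by (auto simp: Basis_vec_def inner_axis lo_def hi_def algebra_simps)
  then have le: "lo \<bullet> e \<le> hi \<bullet> e" if "e \<in> Basis" for e
    using that by (metis inner_diff_left diff_ge_0_iff_ge powr_ge_zero)
  have prod: "(\<Prod>e\<in>Basis. (hi - lo) \<bullet> e) = (3 powr - k) ^ CARD('n)"
    using side by simp
  have iff: "x \<in> cell b k j \<longleftrightarrow> (\<forall>i. lo $ i \<le> x $ i \<and> x $ i < hi $ i)" for x
  proof -
    have "\<lfloor>3 powr k * z + s\<rfloor> = n \<longleftrightarrow> (n - s) * 3 powr - k \<le> z \<and> z < (n + 1 - s) * 3 powr - k" for z s :: real and n :: int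
      by (simp add: floor_eq_iff powr_minus field_simps)
    then show ?thesis
      by (simp add: cell_def lo_def hi_def)
  qed
  have "emeasure lborel (cell b k j) \<le> emeasure lborel (cbox lo hi)"
    by (rule emeasure_mono) (auto simp: iff mem_box_cart less_imp_le)
  moreover have "emeasure lborel (box lo hi) \<le> emeasure lborel (cell b k j)"
    by (rule emeasure_mono) (auto simp: iff mem_box_cart less_imp_le)
  ultimately show ?thesis
    using emeasure_lborel_cbox[OF le] emeasure_lborel_box[OF le] unfolding prod by simp
qed

text \<open>Points closer than \<open>1 / 4\<close> to an integer are at least \<open>1 / 4\<close> away from all half integers.\<close>

lemma floor_shift_stable:
  fixes t :: real
  obtains b :: bool where "\<And>u. \<bar>u - t\<bar> < 1 / 4 \<Longrightarrow>
    \<lfloor>u + (if b then 1 / 2 else 0)\<rfloor> = \<lfloor>t + (if b then 1 / 2 else 0)\<rfloor>"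
proof -
  define n where "n = \<lfloor>t\<rfloor>"
  have n: "of_int n \<le> t" "t < of_int n + 1"
    unfolding n_def by linarith+
  consider "t < of_int n + 1 / 4" | "of_int n + 1 / 4 \<le> t" "t \<le> of_int n + 3 / 4" | "of_int n + 3 / 4 < t"
    by linarith
  then show ?thesis
  proof cases
    case 1
    have "\<lfloor>u + 1 / 2\<rfloor> = n" if "\<bar>u - t\<bar> < 1 / 4" for u
      using that 1 n by (intro floor_unique) linarith+
    from this this[of t] show ?thesis by (intro that[of True]) simp
  next
    case 2
    have "\<lfloor>u\<rfloor> = n" if "\<bar>u - t\<bar> < 1 / 4" for u
      using that 2 n by (intro floor_unique) linarith+
    from this this[of t] show ?thesis by (intro that[of False]) simp
  next
    case 3
    have "\<lfloor>u + 1 / 2\<rfloor> = n + 1" if "\<bar>u - t\<bar> < 1 / 4" for u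
      using that 3 n by (intro floor_unique) (unfold of_int_add of_int_1, linarith+)
    from this this[of t] show ?thesis by (intro that[of True]) simp
  qed
qed

text \<open>The scale is chosen so that the radius is at most a quarter of the side length. In every
coordinate one of the two shifts then keeps the ball inside a cell.\<close>

lemma ball_subset_cell:
  fixes x :: "real ^ 'n"
  assumes r: "0 < r"
  obtains b k j where "ball x r \<subseteq> cell b k j" "3 powr - real_of_int k \<le> 12 * r"
proof -
  define k where "k = \<lfloor>log 3 (1 / (4 * r))\<rfloor>"
  have k: "3 powr k \<le> 1 / (4 * r)" "1 / (4 * r) < 3 * 3 powr k"
  proof -
    have "real_of_int k \<le> log 3 (1 / (4 * r))"
      by (simp add: k_def)
    then show "3 powr k \<le> 1 / (4 * r)"
      using r by (simp add: le_log_iff)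
    have "log 3 (1 / (4 * r)) < real_of_int k + 1"
      unfolding k_def by linarith
    then have "1 / (4 * r) < 3 powr (real_of_int k + 1)"
      using r by (simp add: log_less_iff)
    then show "1 / (4 * r) < 3 * 3 powr k"
      by (simp add: powr_add)
  qed
  have "\<forall>i. \<exists>b. \<forall>u. \<bar>u - 3 powr k * x $ i\<bar> < 1 / 4 \<longrightarrow>
      \<lfloor>u + (if b then 1 / 2 else 0)\<rfloor> = \<lfloor>3 powr k * x $ i + (if b then 1 / 2 else 0)\<rfloor>"
    using floor_shift_stable by metis
  then obtain b where b: "\<And>i u. \<bar>u - 3 powr k * x $ i\<bar> < 1 / 4 \<Longrightarrow>
      \<lfloor>u + (if b i then 1 / 2 else 0)\<rfloor> = \<lfloor>3 powr k * x $ i + (if b i then 1 / 2 else 0)\<rfloor>"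
    by metis
  define b' :: "bool ^ 'n" where "b' = (\<chi> i. b i)"
  define j :: "int ^ 'n" where "j = (\<chi> i. \<lfloor>3 powr k * x $ i + shift b' i\<rfloor>)"
  show ?thesis
  proof
    show "ball x r \<subseteq> cell b' k j"
    proof
      fix y assume y: "y \<in> ball x r"
      have "\<lfloor>3 powr k * y $ i + shift b' i\<rfloor> = j $ i" for i
      proof -
        have "\<bar>y $ i - x $ i\<bar> < r"
          using y component_le_norm_cart[of "y - x" i] by (simp add: dist_norm norm_minus_commute)
        then have "3 powr k * \<bar>y $ i - x $ i\<bar> < 3 powr k * r"
          by simp
        also have "\<dots> \<le> 1 / 4"
          using k(1) r by (simp add: field_simps)
        finally have "\<bar>3 powr k * y $ i - 3 powr k * x $ i\<bar> < 1 / 4"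
          by (simp add: abs_mult flip: right_diff_distrib)
        from b[OF this] show ?thesis
          by (simp add: j_def shift_def b'_def)
      qed
      then show "y \<in> cell b' k j"
        by (simp add: cell_def)
    qed
    show "3 powr - real_of_int k \<le> 12 * r"
      using k(2) r by (simp add: powr_minus field_simps)
  qed
qed

interpretation cells: grids lborel "range grid :: (real ^ 'n) set set set"
proof unfold_locales
  fix E :: "(real ^ 'n) set set" assume "E \<in> range grid"
  then obtain b where E: "E = grid b" by blast
  show "countable E" "laminar E"
    unfolding E by (rule countable_triadic_grid laminar_triadic_grid)+
  show "E \<subseteq> sets lborel"
    unfolding E grid_def by auto
  fix Q assume "Q \<in> E"
  then obtain k j where "Q = cell b k j"
    unfolding E grid_def by blast
  then show "emeasure lborel Q \<noteq> 0" "emeasure lborel Q \<noteq> top"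
    by (simp_all add: emeasure_cell)
qed simp

text \<open>The cell containing the ball has volume at most \<open>(12 r)\<^sup>n\<close>, a fixed multiple of that of the ball.\<close>

lemma ball_average_le_mx:
  fixes g :: "real ^ 'n \<Rightarrow> ennreal"
  assumes r: "0 < r" and x: "x \<in> ball y r"
  shows "(\<integral>\<^sup>+ z\<in>ball y r. g z \<partial>lborel) / emeasure lborel (ball y r)
    \<le> ennreal (12 ^ CARD('n) / unit_ball_vol (real CARD('n))) * maximal_fn lborel (\<Union>(range grid)) g x"
proof -
  let ?n = "CARD('n)"
  let ?V = "unit_ball_vol (real ?n)"
  obtain b k j where Q: "ball y r \<subseteq> cell b k j" and k: "3 powr - real_of_int k \<le> 12 * r"
    using ball_subset_cell[OF r] by blast
  define v where "v = (3 powr - real_of_int k) ^ ?n"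
  have "v \<le> (12 * r) ^ ?n"
    unfolding v_def by (rule power_mono[OF k]) simp
  then have v: "0 < v" "v \<le> 12 ^ ?n * r ^ ?n"
    by (simp_all add: v_def power_mult_distrib)
  have V: "0 < ?V" by simp
  have "(\<integral>\<^sup>+ z\<in>ball y r. g z \<partial>lborel) / emeasure lborel (ball y r)
      = (\<integral>\<^sup>+ z\<in>ball y r. g z \<partial>lborel) * ennreal (1 / (?V * r ^ ?n))"
    using r V by (simp add: emeasure_ball divide_ennreal_eq_mult)
  also have "\<dots> \<le> (\<integral>\<^sup>+ z\<in>cell b k j. g z \<partial>lborel) * ennreal (12 ^ ?n / ?V * (1 / v))"
  proof (rule mult_mono)
    show "(\<integral>\<^sup>+ z\<in>ball y r. g z \<partial>lborel) \<le> (\<integral>\<^sup>+ z\<in>cell b k j. g z \<partial>lborel)"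
      using Q by (intro nn_integral_mono) (auto split: split_indicator)
    have "?V * v \<le> ?V * (12 ^ ?n * r ^ ?n)"
      using v V by (intro mult_left_mono) auto
    then have "1 / (?V * r ^ ?n) \<le> 12 ^ ?n / ?V * (1 / v)"
      using v V r by (simp add: divide_simps mult_ac)
    then show "ennreal (1 / (?V * r ^ ?n)) \<le> ennreal (12 ^ ?n / ?V * (1 / v))"
      by (rule ennreal_leI)
  qed simp_all
  also have "\<dots> = ennreal (12 ^ ?n / ?V) * ((\<integral>\<^sup>+ z\<in>cell b k j. g z \<partial>lborel) / emeasure lborel (cell b k j))"
  proof -
    have "ennreal (12 ^ ?n / ?V * (1 / v)) = ennreal (12 ^ ?n / ?V) * ennreal (1 / v)"
      using v V by (intro ennreal_mult) auto
    then show ?thesis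
      using v by (simp add: emeasure_cell divide_ennreal_eq_mult mult_ac flip: v_def)
  qed
  also have "\<dots> \<le> ennreal (12 ^ ?n / ?V) * maximal_fn lborel (\<Union>(range grid)) g x"
    using Q x by (intro mult_left_mono average_le_maximal_fn) (auto simp: grid_def)
  finally show ?thesis .
qed

section \<open>Weighted inequalities in mixed norms\<close>

text \<open>The mixed norm in the coordinates \<open>1, \<dots>, k\<close> as a function of the others. Taking the root at each
level makes the recursion uniform: passing from \<open>k\<close> to \<open>k + 1\<close> is an ordinary norm in one
variable, also at the first step.\<close>

definition level_norm :: "(nat \<Rightarrow> real) \<Rightarrow> nat \<Rightarrow> ((nat \<Rightarrow> real) \<Rightarrow> ennreal) \<Rightarrow> (nat \<Rightarrow> real) \<Rightarrow> ennreal" where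
  "level_norm p k h t = (if k = 0 then h t else iterated_integral p k h t epowr (1 / p k))"

lemma level_norm_0 [simp]: "level_norm p 0 h t = h t"
  by (simp add: level_norm_def)

lemma iterated_integral_Suc:
  "iterated_integral p (Suc k) h t = (\<integral>\<^sup>+ u. level_norm p k h (t(Suc k := u)) epowr p (Suc k) \<partial>lborel)"
  by (cases k) (simp_all add: level_norm_def nn_integral_completion)

lemma level_norm_Suc_eq:
  "level_norm p (Suc k) h t
    = (\<integral>\<^sup>+ u. level_norm p k h (t(Suc k := u)) epowr p (Suc k) \<partial>lborel) epowr (1 / p (Suc k))"
  unfolding iterated_integral_Suc[symmetric] by (simp add: level_norm_def)

lemma level_norm_Suc:
  "p (Suc k) \<noteq> 0 \<Longrightarrow> level_norm p (Suc k) h t epowr p (Suc k)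
    = (\<integral>\<^sup>+ u. level_norm p k h (t(Suc k := u)) epowr p (Suc k) \<partial>lborel)"
  by (simp add: level_norm_Suc_eq)

lemma mixed_norm_eq_level_norm: "mixed_norm p m g s = level_norm p m (\<lambda>t. g (s, t)) (\<lambda>_. undefined)"
  by (simp add: mixed_norm_def level_norm_def)

abbreviation coords :: "nat \<Rightarrow> (nat \<Rightarrow> real) measure" where
  "coords m \<equiv> (\<Pi>\<^sub>M i\<in>{1..m}. lborel)"

lemma fun_upd_in_space_coords:
  "t \<in> space (coords m) \<Longrightarrow> i \<in> {1..m} \<Longrightarrow> t(i := u) \<in> space (coords m)"
  by (auto simp: space_PiM PiE_iff extensional_def)

text \<open>The coordinates that have been integrated out remain as dummy arguments. Thus all levels are
functions on one and the same product space.\<close>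

lemma measurable_level_norm:
  assumes F: "F \<in> borel_measurable (M \<Otimes>\<^sub>M coords m)" and k: "k \<le> m"
  shows "(\<lambda>(s, t). level_norm p k (\<lambda>t. F (s, t)) t) \<in> borel_measurable (M \<Otimes>\<^sub>M coords m)"
  using k
proof (induction k)
  case 0
  then show ?case
    using F by (simp add: case_prod_beta)
next
  case (Suc k)
  let ?N = "\<lambda>(s, t). level_norm p k (\<lambda>t. F (s, t)) t"
  have upd: "(\<lambda>(x, u). (fst x, (snd x)(Suc k := u))) \<in> (M \<Otimes>\<^sub>M coords m) \<Otimes>\<^sub>M lborel \<rightarrow>\<^sub>M M \<Otimes>\<^sub>M coords m"
  proof -
    have "insert (Suc k) {1..m} = {1..m}"
      using Suc.prems by auto
    then have "(\<lambda>(t, u). t(Suc k := u)) \<in> coords m \<Otimes>\<^sub>M lborel \<rightarrow>\<^sub>M coords m"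
      using measurable_add_dim[of "Suc k" "{1..m}" "\<lambda>_. lborel :: real measure"] by simp
    from measurable_compose[OF _ this, of "\<lambda>(x, u). (snd x, u)" "(M \<Otimes>\<^sub>M coords m) \<Otimes>\<^sub>M lborel"]
    have [measurable]: "(\<lambda>(x, u). (snd x)(Suc k := u)) \<in> (M \<Otimes>\<^sub>M coords m) \<Otimes>\<^sub>M lborel \<rightarrow>\<^sub>M coords m"
      by (simp add: case_prod_beta)
    show ?thesis
      unfolding case_prod_beta
      by (intro measurable_Pair) (use \<open>(\<lambda>(x, u). (snd x)(Suc k := u)) \<in> _\<close> in \<open>auto simp: case_prod_beta\<close>)
  qed
  have [measurable]: "(\<lambda>(x, u). ?N (fst x, (snd x)(Suc k := u)) epowr p (Suc k)) \<in> borel_measurable ((M \<Otimes>\<^sub>M coords m) \<Otimes>\<^sub>M lborel)"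
    using measurable_epowr[OF measurable_compose[OF upd Suc.IH]] Suc.prems by (simp add: case_prod_beta)
  have "(\<lambda>x. (\<integral>\<^sup>+ u. ?N (fst x, (snd x)(Suc k := u)) epowr p (Suc k) \<partial>lborel) epowr (1 / p (Suc k)))
      \<in> borel_measurable (M \<Otimes>\<^sub>M coords m)"
    by measurable
  then show ?case
    by (simp add: level_norm_Suc_eq case_prod_beta)
qed

context grids
begin

text \<open>The two sides of an inequality are given as a set of pairs \<open>(F, H)\<close>, so that the constants are
uniform over it. In the step from \<open>k\<close> to \<open>k + 1\<close>, the inequality for level \<open>k\<close> with exponent
\<open>p\<^sub>k\<^sub>+\<^sub>1\<close> can be integrated over \<open>t\<^sub>k\<^sub>+\<^sub>1\<close>, as the same exponent appears inside and outside and Fubini's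
theorem applies. It becomes the inequality for level \<open>k + 1\<close> with exponent \<open>p\<^sub>k\<^sub>+\<^sub>1\<close>, for all
weights of the class, and extrapolation then permits any exponent in place of \<open>p\<^sub>k\<^sub>+\<^sub>1\<close>.\<close>

theorem mixed_norm_extrapolation:
  fixes R :: "(('a \<times> (nat \<Rightarrow> real) \<Rightarrow> ennreal) \<times> ('a \<times> (nat \<Rightarrow> real) \<Rightarrow> ennreal)) set"
  assumes meas: "\<And>F H. (F, H) \<in> R \<Longrightarrow> F \<in> borel_measurable (M \<Otimes>\<^sub>M coords m) \<and> H \<in> borel_measurable (M \<Otimes>\<^sub>M coords m)"
    and base: "\<And>q c. 1 < q \<Longrightarrow> 0 < c \<Longrightarrow> \<exists>K>(0::real). \<forall>(F, H)\<in>R. \<forall>t\<in>space (coords m). \<forall>w. factored c q w \<longrightarrow>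
      (\<integral>\<^sup>+ s. F (s, t) epowr q * w s \<partial>M) \<le> ennreal K * (\<integral>\<^sup>+ s. H (s, t) epowr q * w s \<partial>M)"
    and p: "\<And>i. i \<in> {1..m} \<Longrightarrow> 1 < p i"
    and k: "k \<le> m" and q: "1 < q" and c: "0 < c"
  shows "\<exists>K>(0::real). \<forall>(F, H)\<in>R. \<forall>t\<in>space (coords m). \<forall>w. factored c q w \<longrightarrow>
    (\<integral>\<^sup>+ s. level_norm p k (\<lambda>t. F (s, t)) t epowr q * w s \<partial>M)
      \<le> ennreal K * (\<integral>\<^sup>+ s. level_norm p k (\<lambda>t. H (s, t)) t epowr q * w s \<partial>M)"
  using k q c
proof (induction k arbitrary: q c)
  case 0
  then show ?case
    using base by simp
next
  case (Suc k)
  let ?r = "p (Suc k)"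
  have r: "1 < ?r" and k: "Suc k \<in> {1..m}" "k \<le> m"
    using p Suc.prems by auto
  obtain c' where c': "0 < c'" and extr: "\<forall>K\<ge>(0::real). \<exists>C>(0::real). \<forall>F H. F \<in> borel_measurable M \<longrightarrow> H \<in> borel_measurable M \<longrightarrow>
    (\<forall>w. factored c' ?r w \<longrightarrow> (\<integral>\<^sup>+ x. F x epowr ?r * w x \<partial>M) \<le> ennreal K * (\<integral>\<^sup>+ x. H x epowr ?r * w x \<partial>M)) \<longrightarrow>
    (\<forall>w. factored c q w \<longrightarrow> (\<integral>\<^sup>+ x. F x epowr q * w x \<partial>M) \<le> ennreal C * (\<integral>\<^sup>+ x. H x epowr q * w x \<partial>M))"
    using extrapolation[OF r Suc.prems(2,3)] by (elim exE conjE) (rule that)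
  obtain K where K: "0 < K" and IH: "\<And>F H t w. (F, H) \<in> R \<Longrightarrow> t \<in> space (coords m) \<Longrightarrow> factored c' ?r w \<Longrightarrow>
    (\<integral>\<^sup>+ s. level_norm p k (\<lambda>t. F (s, t)) t epowr ?r * w s \<partial>M)
      \<le> ennreal K * (\<integral>\<^sup>+ s. level_norm p k (\<lambda>t. H (s, t)) t epowr ?r * w s \<partial>M)"
  proof -
    obtain K where "0 < K" and K: "\<forall>(F, H)\<in>R. \<forall>t\<in>space (coords m). \<forall>w. factored c' ?r w \<longrightarrow>
      (\<integral>\<^sup>+ s. level_norm p k (\<lambda>t. F (s, t)) t epowr ?r * w s \<partial>M)
        \<le> ennreal K * (\<integral>\<^sup>+ s. level_norm p k (\<lambda>t. H (s, t)) t epowr ?r * w s \<partial>M)"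
      using Suc.IH[OF k(2) r c'] by (elim exE conjE) (rule that)
    show ?thesis
    proof (rule that[OF \<open>0 < K\<close>])
      fix F H t w assume "(F, H) \<in> R" "t \<in> space (coords m)" "factored c' ?r w"
      with bspec[OF K, of "(F, H)"]
      show "(\<integral>\<^sup>+ s. level_norm p k (\<lambda>t. F (s, t)) t epowr ?r * w s \<partial>M)
        \<le> ennreal K * (\<integral>\<^sup>+ s. level_norm p k (\<lambda>t. H (s, t)) t epowr ?r * w s \<partial>M)"
        by simp
    qed
  qed
  obtain C where C: "0 < C" and ext: "\<forall>F H. F \<in> borel_measurable M \<longrightarrow> H \<in> borel_measurable M \<longrightarrow>
    (\<forall>w. factored c' ?r w \<longrightarrow> (\<integral>\<^sup>+ x. F x epowr ?r * w x \<partial>M) \<le> ennreal K * (\<integral>\<^sup>+ x. H x epowr ?r * w x \<partial>M)) \<longrightarrow>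
    (\<forall>w. factored c q w \<longrightarrow> (\<integral>\<^sup>+ x. F x epowr q * w x \<partial>M) \<le> ennreal C * (\<integral>\<^sup>+ x. H x epowr q * w x \<partial>M))"
    using mp[OF spec[OF extr] less_imp_le[OF K]] by (elim exE conjE) (rule that)
  note concl = ext[rule_format]
  interpret lM: pair_sigma_finite lborel M ..
  have slice1: "(\<lambda>s. level_norm p l (\<lambda>t. F (s, t)) t) \<in> borel_measurable M"
    if "F \<in> borel_measurable (M \<Otimes>\<^sub>M coords m)" "l \<le> m" "t \<in> space (coords m)" for F l t
    using measurable_compose[OF measurable_Pair2'[OF that(3)] measurable_level_norm[OF that(1,2)]] by simp
  have joint: "(\<lambda>(u, s). level_norm p k (\<lambda>t. F (s, t)) (t(Suc k := u)) epowr ?r * ennreal (w s))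
      \<in> borel_measurable (lborel \<Otimes>\<^sub>M M)"
    if F: "F \<in> borel_measurable (M \<Otimes>\<^sub>M coords m)" and t: "t \<in> space (coords m)" and w: "factored c' ?r w" for F t w
  proof -
    have [measurable]: "w \<in> borel_measurable M"
      using w by (rule factored_weight_measurable)
    have [measurable]: "(\<lambda>u. t(Suc k := u)) \<in> lborel \<rightarrow>\<^sub>M coords m"
      using k(1) t by (intro measurable_PiM_single') (auto simp: space_PiM PiE_iff extensional_def fun_upd_def)
    have "(\<lambda>x. (snd x, t(Suc k := fst x))) \<in> lborel \<Otimes>\<^sub>M M \<rightarrow>\<^sub>M M \<Otimes>\<^sub>M coords m"
      by measurable
    from measurable_compose[OF this measurable_level_norm[OF F k(2)]]
    have [measurable]: "(\<lambda>x. level_norm p k (\<lambda>t. F (snd x, t)) (t(Suc k := fst x))) \<in> borel_measurable (lborel \<Otimes>\<^sub>M M)"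
      by simp
    show ?thesis
      unfolding case_prod_beta by measurable
  qed
  have slice: "(\<lambda>u. level_norm p k (\<lambda>t. F (s, t)) (t(Suc k := u))) \<in> borel_measurable lborel"
    if F: "F \<in> borel_measurable (M \<Otimes>\<^sub>M coords m)" and t: "t \<in> space (coords m)" and s: "s \<in> space M" for F t s
  proof -
    have [measurable]: "(\<lambda>u. t(Suc k := u)) \<in> lborel \<rightarrow>\<^sub>M coords m"
      using k(1) t by (intro measurable_PiM_single') (auto simp: space_PiM PiE_iff extensional_def fun_upd_def)
    have "(\<lambda>u. (s, t(Suc k := u))) \<in> lborel \<rightarrow>\<^sub>M M \<Otimes>\<^sub>M coords m"
      using s by measurable
    from measurable_compose[OF this measurable_level_norm[OF F k(2)]] show ?thesis
      by simp
  qed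
  have fubini: "(\<integral>\<^sup>+ s. level_norm p (Suc k) (\<lambda>t. F (s, t)) t epowr ?r * w s \<partial>M)
      = (\<integral>\<^sup>+ u. \<integral>\<^sup>+ s. level_norm p k (\<lambda>t. F (s, t)) (t(Suc k := u)) epowr ?r * w s \<partial>M \<partial>lborel)"
    if F: "F \<in> borel_measurable (M \<Otimes>\<^sub>M coords m)" and t: "t \<in> space (coords m)" and w: "factored c' ?r w" for F t w
  proof -
    have "(\<integral>\<^sup>+ s. level_norm p (Suc k) (\<lambda>t. F (s, t)) t epowr ?r * w s \<partial>M)
      = (\<integral>\<^sup>+ s. \<integral>\<^sup>+ u. level_norm p k (\<lambda>t. F (s, t)) (t(Suc k := u)) epowr ?r * w s \<partial>lborel \<partial>M)"
    proof (rule nn_integral_cong)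
      fix s assume "s \<in> space M"
      note [measurable] = slice[OF F t this]
      show "level_norm p (Suc k) (\<lambda>t. F (s, t)) t epowr ?r * w s
          = (\<integral>\<^sup>+ u. level_norm p k (\<lambda>t. F (s, t)) (t(Suc k := u)) epowr ?r * w s \<partial>lborel)"
        using r by (simp add: level_norm_Suc nn_integral_multc)
    qed
    also have "\<dots> = (\<integral>\<^sup>+ u. \<integral>\<^sup>+ s. level_norm p k (\<lambda>t. F (s, t)) (t(Suc k := u)) epowr ?r * w s \<partial>M \<partial>lborel)"
      by (rule lM.Fubini'[OF joint[OF F t w]])
    finally show ?thesis .
  qed
  show ?case
  proof (intro exI[of _ C] conjI ballI allI impI C, clarify)
    fix F H t w
    assume FH: "(F, H) \<in> R" and t: "t \<in> space (coords m)" and w: "factored c q w"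
    have F: "F \<in> borel_measurable (M \<Otimes>\<^sub>M coords m)" and H: "H \<in> borel_measurable (M \<Otimes>\<^sub>M coords m)"
      using meas[OF FH] by auto
    show "(\<integral>\<^sup>+ s. level_norm p (Suc k) (\<lambda>t. F (s, t)) t epowr q * w s \<partial>M)
      \<le> ennreal C * (\<integral>\<^sup>+ s. level_norm p (Suc k) (\<lambda>t. H (s, t)) t epowr q * w s \<partial>M)"
    proof (rule concl[OF slice1[OF F Suc.prems(1) t] slice1[OF H Suc.prems(1) t] _ w])
      fix v assume v: "factored c' ?r v"
      have [measurable]: "v \<in> borel_measurable M"
        using v by (rule factored_weight_measurable)
      have "(\<integral>\<^sup>+ s. level_norm p (Suc k) (\<lambda>t. F (s, t)) t epowr ?r * v s \<partial>M)
          = (\<integral>\<^sup>+ u. \<integral>\<^sup>+ s. level_norm p k (\<lambda>t. F (s, t)) (t(Suc k := u)) epowr ?r * v s \<partial>M \<partial>lborel)"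
        by (rule fubini[OF F t v])
      also have "\<dots> \<le> (\<integral>\<^sup>+ u. ennreal K * (\<integral>\<^sup>+ s. level_norm p k (\<lambda>t. H (s, t)) (t(Suc k := u)) epowr ?r * v s \<partial>M) \<partial>lborel)"
        by (intro nn_integral_mono IH[OF FH _ v] fun_upd_in_space_coords t k)
      also have "\<dots> = ennreal K * (\<integral>\<^sup>+ u. \<integral>\<^sup>+ s. level_norm p k (\<lambda>t. H (s, t)) (t(Suc k := u)) epowr ?r * v s \<partial>M \<partial>lborel)"
        using borel_measurable_nn_integral[OF joint[OF H t v]] by (rule nn_integral_cmult)
      also have "\<dots> = ennreal K * (\<integral>\<^sup>+ s. level_norm p (Suc k) (\<lambda>t. H (s, t)) t epowr ?r * v s \<partial>M)"
        by (simp only: fubini[OF H t v])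
      finally show "(\<integral>\<^sup>+ s. level_norm p (Suc k) (\<lambda>t. F (s, t)) t epowr ?r * v s \<partial>M)
          \<le> ennreal K * (\<integral>\<^sup>+ s. level_norm p (Suc k) (\<lambda>t. H (s, t)) t epowr ?r * v s \<partial>M)" .
    qed
  qed
qed

end

section \<open>From Lebesgue to Borel measurable functions\<close>

lemma sigma_finite_coords: "sigma_finite_measure (coords m)"
proof -
  interpret product_sigma_finite "\<lambda>_ :: nat. lborel :: real measure" ..
  show ?thesis
    by (rule sigma_finite) simp
qed

lemma level_norm_one: "level_norm (\<lambda>_. 1) k h t = iterated_integral (\<lambda>_. 1) k h t"
  by (simp add: level_norm_def)

text \<open>For exponents \<open>1\<close> the iterated integral is the integral over the product measure. It is used to
see that null sets are negligible in iterated norms.\<close>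

lemma iterated_integral_one_eq:
  assumes h: "h \<in> borel_measurable (coords m)" and "k \<le> m" "t \<in> space (coords m)"
  shows "iterated_integral (\<lambda>_. 1) k h t = (\<integral>\<^sup>+ x. h (\<lambda>i. if i \<in> {1..k} then x i else t i) \<partial>coords k)"
  using assms(2,3)
proof (induction k arbitrary: t)
  case 0
  interpret product_sigma_finite "\<lambda>_ :: nat. lborel :: real measure" ..
  show ?case
    using nn_integral_empty[of "\<lambda>x. h (\<lambda>i. if i \<in> {1..0} then x i else t i)"] by simp
next
  case (Suc k)
  interpret product_sigma_finite "\<lambda>_ :: nat. lborel :: real measure" ..
  let ?g = "\<lambda>x. h (\<lambda>i. if i \<in> {1..Suc k} then x i else t i)"
  have eq: "{1..Suc k} = insert (Suc k) {1..k}"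
    by auto
  have "(\<lambda>x i. if i \<in> {1..Suc k} then x i else t i) \<in> coords (Suc k) \<rightarrow>\<^sub>M coords m"
  proof (rule measurable_PiM_single')
    fix i assume "i \<in> {1..m}"
    show "(\<lambda>x. if i \<in> {1..Suc k} then x i else t i) \<in> coords (Suc k) \<rightarrow>\<^sub>M lborel"
      by (cases "i \<in> {1..Suc k}") auto
  qed (use Suc.prems in \<open>auto simp: space_PiM PiE_iff extensional_def\<close>)
  from measurable_compose[OF this h]
  have g: "?g \<in> borel_measurable (\<Pi>\<^sub>M i\<in>insert (Suc k) {1..k}. lborel)"
    unfolding eq by simp
  have "iterated_integral (\<lambda>_. 1) (Suc k) h t = (\<integral>\<^sup>+ u. iterated_integral (\<lambda>_. 1) k h (t(Suc k := u)) \<partial>lborel)"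
    by (simp add: iterated_integral_Suc level_norm_one)
  also have "\<dots> = (\<integral>\<^sup>+ u. \<integral>\<^sup>+ x. ?g (x(Suc k := u)) \<partial>coords k \<partial>lborel)"
  proof (rule nn_integral_cong)
    fix u :: real
    have "iterated_integral (\<lambda>_. 1) k h (t(Suc k := u))
        = (\<integral>\<^sup>+ x. h (\<lambda>i. if i \<in> {1..k} then x i else (t(Suc k := u)) i) \<partial>coords k)"
      using Suc.prems by (intro Suc.IH fun_upd_in_space_coords) auto
    also have "\<dots> = (\<integral>\<^sup>+ x. ?g (x(Suc k := u)) \<partial>coords k)"
      by (intro nn_integral_cong arg_cong[where f=h] ext) auto
    finally show "iterated_integral (\<lambda>_. 1) k h (t(Suc k := u)) = (\<integral>\<^sup>+ x. ?g (x(Suc k := u)) \<partial>coords k)" .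
  qed
  also have "\<dots> = (\<integral>\<^sup>+ x. ?g x \<partial>coords (Suc k))"
  proof -
    have "(\<integral>\<^sup>+ x. ?g x \<partial>(\<Pi>\<^sub>M i\<in>insert (Suc k) {1..k}. lborel)) = (\<integral>\<^sup>+ u. \<integral>\<^sup>+ x. ?g (x(Suc k := u)) \<partial>coords k \<partial>lborel)"
      by (rule product_nn_integral_insert_rev[OF _ _ g]) auto
    then show ?thesis
      unfolding eq[symmetric] by (rule sym)
  qed
  finally show ?case .
qed

lemma undefined_in_space_coords: "(\<lambda>_. undefined) \<in> space (coords m)"
  by (auto simp: space_PiM PiE_iff extensional_def)

text \<open>Let \<open>N\<close> be a null set off which \<open>h \<le> h'\<close>. Its iterated measure \<open>J\<close> vanishes at the top level. Where
\<open>J\<close> vanishes at level \<open>k + 1\<close>, it vanishes at level \<open>k\<close> for almost every value of the next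
coordinate, and so the inequality climbs from level to level.\<close>

lemma level_norm_mono_AE:
  assumes ae: "AE t in coords m. h t \<le> h' t" and p: "\<And>i. i \<in> {1..m} \<Longrightarrow> 0 < p i"
  shows "level_norm p m h (\<lambda>_. undefined) \<le> level_norm p m h' (\<lambda>_. undefined)"
proof -
  obtain N where N: "{t \<in> space (coords m). \<not> h t \<le> h' t} \<subseteq> N" "emeasure (coords m) N = 0" "N \<in> sets (coords m)"
    using ae by (rule AE_E)
  define J where "J k = iterated_integral (\<lambda>_. 1) k (indicator N)" for k
  have le: "J k t = 0 \<longrightarrow> level_norm p k h t \<le> level_norm p k h' t"
    if "k \<le> m" "t \<in> space (coords m)" for k t
    using that
  proof (induction k arbitrary: t)
    case 0
    then show ?case
      using N(1) by (auto simp: J_def indicator_def split: if_splits)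
  next
    case (Suc k)
    have k: "Suc k \<in> {1..m}" "k \<le> m" using Suc.prems by auto
    show ?case
    proof
      assume 0: "J (Suc k) t = 0"
      have [measurable]: "(\<lambda>u. J k (t(Suc k := u))) \<in> borel_measurable lborel"
      proof -
        have [measurable]: "(\<lambda>u. t(Suc k := u)) \<in> lborel \<rightarrow>\<^sub>M coords m"
          using k Suc.prems by (intro measurable_PiM_single') (auto simp: space_PiM PiE_iff extensional_def fun_upd_def)
        have "(\<lambda>u. (0 :: real, t(Suc k := u))) \<in> lborel \<rightarrow>\<^sub>M (lborel \<Otimes>\<^sub>M coords m)"
          by measurable
        moreover have "(\<lambda>x. indicator N (snd x) :: ennreal) \<in> borel_measurable ((lborel :: real measure) \<Otimes>\<^sub>M coords m)"
          using N(3) by measurable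
        ultimately have "(\<lambda>u. level_norm (\<lambda>_. 1) k (\<lambda>t. indicator N t) (t(Suc k := u))) \<in> borel_measurable lborel"
          using measurable_compose[OF _ measurable_level_norm[OF _ k(2), of "\<lambda>x. indicator N (snd x)" lborel "\<lambda>_. 1"],
            of "\<lambda>u. (0 :: real, t(Suc k := u))" lborel] by simp
        then show ?thesis
          by (simp add: J_def level_norm_one)
      qed
      have "(\<integral>\<^sup>+ u. J k (t(Suc k := u)) \<partial>lborel) = 0"
        using 0 by (simp add: J_def iterated_integral_Suc level_norm_one)
      then have "AE u in lborel. J k (t(Suc k := u)) = 0"
        by (subst (asm) nn_integral_0_iff_AE) auto
      then have "AE u in lborel. level_norm p k h (t(Suc k := u)) epowr p (Suc k)
          \<le> level_norm p k h' (t(Suc k := u)) epowr p (Suc k)"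
      proof eventually_elim
        case (elim u)
        have "level_norm p k h (t(Suc k := u)) \<le> level_norm p k h' (t(Suc k := u))"
          by (rule mp[OF Suc.IH[OF k(2) fun_upd_in_space_coords[OF Suc.prems(2) k(1)]] elim])
        then show ?case
          by (rule epowr_mono[OF less_imp_le[OF p[OF k(1)]]])
      qed
      then have "(\<integral>\<^sup>+ u. level_norm p k h (t(Suc k := u)) epowr p (Suc k) \<partial>lborel)
          \<le> (\<integral>\<^sup>+ u. level_norm p k h' (t(Suc k := u)) epowr p (Suc k) \<partial>lborel)"
        by (rule nn_integral_mono_AE)
      then show "level_norm p (Suc k) h t \<le> level_norm p (Suc k) h' t"
        using p[OF k(1)] unfolding level_norm_Suc_eq by (intro epowr_mono) auto
    qed
  qed
  have "J m (\<lambda>_. undefined) = (\<integral>\<^sup>+ x. indicator N (\<lambda>i. if i \<in> {1..m} then x i else undefined) \<partial>coords m)"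
    unfolding J_def using N(3) undefined_in_space_coords by (intro iterated_integral_one_eq) auto
  also have "\<dots> = (\<integral>\<^sup>+ x. indicator N x \<partial>coords m)"
  proof (rule nn_integral_cong)
    fix x assume "x \<in> space (coords m)"
    then have "(\<lambda>i. if i \<in> {1..m} then x i else undefined) = x"
      by (auto simp: space_PiM PiE_iff extensional_def)
    then show "indicator N (\<lambda>i. if i \<in> {1..m} then x i else undefined) = (indicator N x :: ennreal)"
      by simp
  qed
  also have "\<dots> = 0"
    using N by simp
  finally show ?thesis
    using le[OF order_refl undefined_in_space_coords] by simp
qed

text \<open>Both orders of the variables are needed: the maximal function sees whole sections in \<open>s\<close>, the
mixed norm sections in \<open>t\<close>.\<close>

lemma lebesgue_prod_Borel_representative:
  fixes f :: "(real ^ 'n) \<times> (nat \<Rightarrow> real) \<Rightarrow> complex"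
  assumes f: "f \<in> borel_measurable (lebesgue_prod m)"
  obtains g :: "(real ^ 'n) \<times> (nat \<Rightarrow> real) \<Rightarrow> ennreal" where "g \<in> borel_measurable (lborel \<Otimes>\<^sub>M coords m)"
    "AE s in lborel. AE t in coords m. ennreal (norm (f (s, t))) = g (s, t)"
    "AE t in coords m. AE s in lborel. ennreal (norm (f (s, t))) = g (s, t)"
proof -
  interpret pair_sigma_finite "lborel :: (real ^ 'n) measure" "coords m"
    by (intro pair_sigma_finite.intro sigma_finite_coords) unfold_locales
  let ?P = "(lborel :: (real ^ 'n) measure) \<Otimes>\<^sub>M coords m"
  have "(\<lambda>x. ennreal (norm (f x))) \<in> borel_measurable (completion ?P)"
    using f unfolding lebesgue_prod_def by measurable
  then obtain g where g: "g \<in> borel_measurable ?P" and ae: "AE x in ?P. ennreal (norm (f x)) = g x"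
    using completion_ex_borel_measurable by blast
  obtain N where N: "{x \<in> space ?P. \<not> ennreal (norm (f x)) = g x} \<subseteq> N" "emeasure ?P N = 0" "N \<in> sets ?P"
    using ae by (rule AE_E)
  have notN: "ennreal (norm (f (s, t))) = g (s, t)" if "(s, t) \<notin> N" "t \<in> space (coords m)" for s t
    using N(1) that by (auto simp: space_pair_measure)
  have "AE x in ?P. x \<notin> N"
    using N(2,3) by (intro AE_not_in) (auto simp: null_sets_def)
  then have 1: "AE s in lborel. AE t in coords m. (s, t) \<notin> N"
    by (rule AE_pair)
  have "{x \<in> space ?P. (fst x, snd x) \<notin> N} \<in> sets ?P"
  proof -
    have "{x \<in> space ?P. (fst x, snd x) \<notin> N} = space ?P - N"
      by auto
    then show ?thesis
      using N(3) by (simp only: sets.compl_sets)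
  qed
  from AE_commute[OF this] 1 have 2: "AE t in coords m. AE s in lborel. (s, t) \<notin> N"
    by simp
  show ?thesis
  proof (rule that[OF g])
    show "AE s in lborel. AE t in coords m. ennreal (norm (f (s, t))) = g (s, t)"
      using 1
    proof eventually_elim
      case (elim s)
      then have "AE t in coords m. t \<in> space (coords m) \<and> (s, t) \<notin> N"
        by (intro AE_conjI AE_space)
      then show ?case
        by eventually_elim (auto intro: notN)
    qed
    have "AE t in coords m. t \<in> space (coords m) \<and> (AE s in lborel. (s, t) \<notin> N)"
      using 2 by (intro AE_conjI AE_space)
    then show "AE t in coords m. AE s in lborel. ennreal (norm (f (s, t))) = g (s, t)"
    proof eventually_elim
      case (elim t)
      then have "AE s in lborel. (s, t) \<notin> N" by simp
      then show ?case
        by eventually_elim (use elim in \<open>auto intro: notN\<close>)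
    qed
  qed
qed

text \<open>The bound holds for every \<open>s\<close>, since changing a section of \<open>f\<close> on a null set does not affect the
means over balls.\<close>

lemma partial_maximal_le_mx:
  fixes f :: "(real ^ 'n) \<times> (nat \<Rightarrow> real) \<Rightarrow> complex"
  assumes "AE y in lborel. ennreal (norm (f (y, t))) = g (y, t)"
  shows "partial_maximal f (s, t)
    \<le> ennreal (12 ^ CARD('n) / unit_ball_vol (real CARD('n))) * cells.mx (\<lambda>y. g (y, t)) s"
  unfolding partial_maximal_def prod.case
proof (rule SUP_least)
  fix r :: real assume "r \<in> {0<..}"
  then have r: "0 < r" by simp
  have "(\<integral>\<^sup>+ y\<in>ball s r. ennreal (norm (f (y, t))) \<partial>lebesgue) = (\<integral>\<^sup>+ y\<in>ball s r. g (y, t) \<partial>lborel)"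
    unfolding nn_integral_completion using assms by (intro nn_integral_cong_AE) (auto elim!: eventually_mono)
  then show "(\<integral>\<^sup>+ y\<in>ball s r. ennreal (norm (f (y, t))) \<partial>lebesgue) / emeasure lebesgue (ball s r)
      \<le> ennreal (12 ^ CARD('n) / unit_ball_vol (real CARD('n))) * cells.mx (\<lambda>y. g (y, t)) s"
    using ball_average_le_mx[OF r, of s s "\<lambda>y. g (y, t)"] r by simp
qed

context grids
begin

text \<open>Only countably many cells enter the supremum, unlike in the supremum over all balls.\<close>

lemma measurable_partial_mx:
  assumes H: "H \<in> borel_measurable (M \<Otimes>\<^sub>M N)"
  shows "(\<lambda>(s, t). mx (\<lambda>s. H (s, t)) s) \<in> borel_measurable (M \<Otimes>\<^sub>M N)"
  unfolding maximal_fn_def case_prod_beta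
proof (rule borel_measurable_SUP[OF countable_Union_grids])
  fix Q assume "Q \<in> \<Union>G"
  then have [measurable]: "Q \<in> sets M"
    using sets_grid by auto
  note [measurable] = H
  have [measurable]: "(\<lambda>t. \<integral>\<^sup>+ y\<in>Q. H (y, t) \<partial>M) \<in> borel_measurable N"
    by measurable
  show "(\<lambda>x. indicator Q (fst x) * ((\<integral>\<^sup>+ y\<in>Q. H (y, snd x) \<partial>M) / emeasure M Q)) \<in> borel_measurable (M \<Otimes>\<^sub>M N)"
    by measurable
qed

lemma partial_mx_bound:
  assumes q: "1 < q" and c: "0 < c" and a: "0 < a"
  shows "\<exists>K>(0::real). \<forall>H\<in>borel_measurable (M \<Otimes>\<^sub>M N). \<forall>t\<in>space N. \<forall>w. factored c q w \<longrightarrow>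
    (\<integral>\<^sup>+ s. (ennreal a * mx (\<lambda>s. H (s, t)) s) epowr q * w s \<partial>M) \<le> ennreal K * (\<integral>\<^sup>+ s. H (s, t) epowr q * w s \<partial>M)"
proof -
  obtain K where K: "0 < K" "\<And>w f. factored c q w \<Longrightarrow> f \<in> borel_measurable M \<Longrightarrow>
    (\<integral>\<^sup>+ x. mx f x epowr q * w x \<partial>M) \<le> ennreal K * (\<integral>\<^sup>+ x. f x epowr q * w x \<partial>M)"
    using muckenhoupt_factored[OF q c] by blast
  show ?thesis
  proof (rule exI[of _ "a powr q * K"], intro conjI ballI allI impI)
    show "0 < a powr q * K" using a K by simp
    fix H :: "'a \<times> 'b \<Rightarrow> ennreal" and t w
    assume H: "H \<in> borel_measurable (M \<Otimes>\<^sub>M N)" and t: "t \<in> space N" and w: "factored c q w"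
    note [measurable] = factored_weight_measurable[OF w]
    have [measurable]: "(\<lambda>s. H (s, t)) \<in> borel_measurable M"
      using measurable_compose[OF measurable_Pair2'[OF t] H] .
    have "(\<integral>\<^sup>+ s. (ennreal a * mx (\<lambda>s. H (s, t)) s) epowr q * w s \<partial>M)
        = (\<integral>\<^sup>+ s. ennreal (a powr q) * (mx (\<lambda>s. H (s, t)) s epowr q * w s) \<partial>M)"
      using a q by (intro nn_integral_cong) (simp add: epowr_mult epowr_ennreal mult.assoc)
    also have "\<dots> = ennreal (a powr q) * (\<integral>\<^sup>+ s. mx (\<lambda>s. H (s, t)) s epowr q * w s \<partial>M)"
      by (rule nn_integral_cmult) measurable
    also have "\<dots> \<le> ennreal (a powr q) * (ennreal K * (\<integral>\<^sup>+ s. H (s, t) epowr q * w s \<partial>M))"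
      by (intro mult_left_mono K(2)[OF w]) auto
    also have "\<dots> = ennreal (a powr q * K) * (\<integral>\<^sup>+ s. H (s, t) epowr q * w s \<partial>M)"
      using K by (simp add: ennreal_mult mult.assoc)
    finally show "(\<integral>\<^sup>+ s. (ennreal a * mx (\<lambda>s. H (s, t)) s) epowr q * w s \<partial>M)
      \<le> ennreal (a powr q * K) * (\<integral>\<^sup>+ s. H (s, t) epowr q * w s \<partial>M)" .
  qed
qed

end

section \<open>The maximal inequality in mixed norms\<close>

text \<open>At level \<open>m\<close> and with the weight \<open>1\<close>, the extrapolated inequality is the assertion for Borel
functions, with the maximal function over cubes. Neither mixed norm sees null sets, so that it
carries over to \<open>f\<close> and \<open>f\<^sup>*\<close>.\<close>

theorem theorem2p12:
  fixes m :: nat and p :: "nat \<Rightarrow> real" and q :: real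
  assumes "\<And>i. i \<in> {1..m} \<Longrightarrow> 1 < p i"
    and "1 < q"
  shows "\<exists>C::real. C > 0 \<and>
    (\<forall>f :: (real ^ 'n) \<times> (nat \<Rightarrow> real) \<Rightarrow> complex. locally_integrable m f \<longrightarrow>
      (\<integral>\<^sup>+ s. mixed_norm p m (partial_maximal f) s epowr q \<partial>lebesgue)
      \<le> ennreal C * (\<integral>\<^sup>+ s. mixed_norm p m (\<lambda>x. ennreal (norm (f x))) s epowr q \<partial>lebesgue))"
proof -
  define a where "a = 12 ^ CARD('n) / unit_ball_vol (real CARD('n))"
  have a: "0 < a" by (simp add: a_def)
  let ?P = "(lborel :: (real ^ 'n) measure) \<Otimes>\<^sub>M coords m"
  define MX where "MX H = (\<lambda>(s, t). ennreal a * cells.mx (\<lambda>s. H (s, t)) s)"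
    for H :: "(real ^ 'n) \<times> (nat \<Rightarrow> real) \<Rightarrow> ennreal"
  define R where "R = {(MX H, H) | H. H \<in> borel_measurable ?P}"
  have meas: "F \<in> borel_measurable ?P \<and> H \<in> borel_measurable ?P" if "(F, H) \<in> R" for F H
  proof -
    have H: "H \<in> borel_measurable ?P" and F: "F = MX H"
      using that by (auto simp: R_def)
    have "(\<lambda>x. ennreal a * (\<lambda>(s, t). cells.mx (\<lambda>s. H (s, t)) s) x) \<in> borel_measurable ?P"
      using cells.measurable_partial_mx[OF H] by measurable
    with H show ?thesis
      by (simp add: F MX_def case_prod_beta)
  qed
  have base: "\<exists>K>(0::real). \<forall>(F, H)\<in>R. \<forall>t\<in>space (coords m). \<forall>w. cells.factored c r w \<longrightarrow>
      (\<integral>\<^sup>+ s. F (s, t) epowr r * w s \<partial>lborel) \<le> ennreal K * (\<integral>\<^sup>+ s. H (s, t) epowr r * w s \<partial>lborel)"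
    if r: "1 < r" and c: "0 < c" for r c
  proof -
    obtain K :: real where K: "0 < K" and bound: "\<forall>H\<in>borel_measurable ?P. \<forall>t\<in>space (coords m). \<forall>w. cells.factored c r w \<longrightarrow>
      (\<integral>\<^sup>+ s. (ennreal a * cells.mx (\<lambda>s. H (s, t)) s) epowr r * w s \<partial>lborel)
        \<le> ennreal K * (\<integral>\<^sup>+ s. H (s, t) epowr r * w s \<partial>lborel)"
      using cells.partial_mx_bound[OF r c a, of "coords m"] by (elim exE conjE) (rule that)
    show ?thesis
    proof (rule exI[of _ K], intro conjI K ballI, clarify)
      fix F H t and w :: "real ^ 'n \<Rightarrow> real"
      assume "(F, H) \<in> R" and t: "t \<in> space (coords m)" and w: "cells.factored c r w"
      then have "H \<in> borel_measurable ?P" "F = MX H"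
        by (auto simp: R_def)
      then show "(\<integral>\<^sup>+ s. F (s, t) epowr r * w s \<partial>lborel) \<le> ennreal K * (\<integral>\<^sup>+ s. H (s, t) epowr r * w s \<partial>lborel)"
        using bound t w by (simp add: MX_def)
    qed
  qed
  have "\<exists>K>(0::real). \<forall>(F, H)\<in>R. \<forall>t\<in>space (coords m). \<forall>w. cells.factored 1 q w \<longrightarrow>
    (\<integral>\<^sup>+ s. level_norm p m (\<lambda>t. F (s, t)) t epowr q * w s \<partial>lborel)
      \<le> ennreal K * (\<integral>\<^sup>+ s. level_norm p m (\<lambda>t. H (s, t)) t epowr q * w s \<partial>lborel)"
    by (rule cells.mixed_norm_extrapolation[of R m p m])
      (rule meas base assms order_refl zero_less_one | assumption)+
  then obtain K :: real where K: "0 < K" and bound: "\<forall>(F, H)\<in>R. \<forall>t\<in>space (coords m). \<forall>w. cells.factored 1 q w \<longrightarrow>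
    (\<integral>\<^sup>+ s. level_norm p m (\<lambda>t. F (s, t)) t epowr q * w s \<partial>lborel)
      \<le> ennreal K * (\<integral>\<^sup>+ s. level_norm p m (\<lambda>t. H (s, t)) t epowr q * w s \<partial>lborel)"
    by (elim exE conjE) (rule that)
  show ?thesis
  proof (intro exI[of _ K] conjI K allI impI)
    fix f :: "(real ^ 'n) \<times> (nat \<Rightarrow> real) \<Rightarrow> complex"
    assume "locally_integrable m f"
    then have "f \<in> borel_measurable (lebesgue_prod m)"
      by (simp add: locally_integrable_def)
    then obtain g where g: "g \<in> borel_measurable ?P"
      and fg: "AE s in lborel. AE t in coords m. ennreal (norm (f (s, t))) = g (s, t)"
        "AE t in coords m. AE s in lborel. ennreal (norm (f (s, t))) = g (s, t)"
      by (rule lebesgue_prod_Borel_representative)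
    have p: "0 < p i" if "i \<in> {1..m}" for i
      using assms(1)[OF that] by simp
    let ?o = "\<lambda>_ :: nat. undefined :: real"
    have "(\<integral>\<^sup>+ s. mixed_norm p m (partial_maximal f) s epowr q \<partial>lebesgue)
        \<le> (\<integral>\<^sup>+ s. level_norm p m (\<lambda>t. MX g (s, t)) ?o epowr q \<partial>lborel)"
      unfolding nn_integral_completion mixed_norm_eq_level_norm
    proof (intro nn_integral_mono epowr_mono level_norm_mono_AE p)
      fix s :: "real ^ 'n"
      show "AE t in coords m. partial_maximal f (s, t) \<le> MX g (s, t)"
        using fg(2) by eventually_elim (simp add: MX_def a_def partial_maximal_le_mx)
    qed (use assms(2) in auto)
    also have "\<dots> \<le> ennreal K * (\<integral>\<^sup>+ s. level_norm p m (\<lambda>t. g (s, t)) ?o epowr q \<partial>lborel)"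
    proof -
      have "(MX g, g) \<in> R"
        using g by (auto simp: R_def)
      moreover have "cells.factored 1 q (\<lambda>_ :: real ^ 'n. 1)"
        using cells.sets_grid by (intro factored_weight_1) auto
      ultimately show ?thesis
        using bspec[OF bound, of "(MX g, g)"] undefined_in_space_coords[of m] by fastforce
    qed
    also have "(\<integral>\<^sup>+ s. level_norm p m (\<lambda>t. g (s, t)) ?o epowr q \<partial>lborel)
        \<le> (\<integral>\<^sup>+ s. mixed_norm p m (\<lambda>x. ennreal (norm (f x))) s epowr q \<partial>lebesgue)"
      unfolding nn_integral_completion mixed_norm_eq_level_norm
    proof (rule nn_integral_mono_AE)
      show "AE s in lborel. level_norm p m (\<lambda>t. g (s, t)) ?o epowr q
          \<le> level_norm p m (\<lambda>t. ennreal (norm (f (s, t)))) ?o epowr q"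
        using fg(1)
      proof eventually_elim
        case (elim s)
        then have "AE t in coords m. g (s, t) \<le> ennreal (norm (f (s, t)))"
          by eventually_elim simp
        then show ?case
          using assms(2) by (intro epowr_mono level_norm_mono_AE p) auto
      qed
    qed
    finally show "(\<integral>\<^sup>+ s. mixed_norm p m (partial_maximal f) s epowr q \<partial>lebesgue)
      \<le> ennreal K * (\<integral>\<^sup>+ s. mixed_norm p m (\<lambda>x. ennreal (norm (f x))) s epowr q \<partial>lebesgue)"
      by (simp add: mult_left_mono)
  qed
qed

end
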